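(* Let $\gamma$ and its dual curve $\Gamma$ be smooth convex closed curves of everywhere positive curvature, with $O$ inside, and let $r=r(\varphi)$ be the equation of $\Gamma$ in polar coordinates $(r,\varphi)$ centered at $O$. The Angular billiard map $\mathcal{A}$ of $\Gamma$, considered on points $M_1$ for which the segment $[M_1,\mathcal{A}(M_1)]$ is tangent to $\Gamma$ at a point of the segment (in particular near $\Gamma$), preserves the symplectic form $d\left(\frac1r\right)\wedge d\varphi$ and can be written with the help of the generating function $$S(\varphi_1,\varphi_2)=\frac{2}{r\left(\frac{\varphi_1+\varphi_2}{2}\right)}\sin\left(\frac{\varphi_2-\varphi_1}{2}\right),$$ that is, if $M_1=r_1e^{i\varphi_1}$ and $\mathcal{A}(M_1)=M_2=r_2e^{i\varphi_2}$, then $$-\frac{\partial S}{\partial\varphi_1}(\varphi_1,\varphi_2)=\frac1{r_1},\qquad \frac{\partial S}{\partial\varphi_2}(\varphi_1,\varphi_2)=\frac1{r_2}.$$ Moreover, $\mathcal{A}$ is a twist map near the boundary $\Gamma$, i.e. $S$ satisfies the twist condition $$\frac{\partial^2S}{\partial\varphi_1\partial\varphi_2}>0.$$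
   Context: Duality: with Euclidean coordinates centered at $O$, the line $\{\langle n,X\rangle=p\}$ with $|n|=1$, $p>0$, corresponds to the point $n/p$; $\Gamma$ is the set of points dual to the tangent lines of $\gamma$. Thus $p(\varphi)=1/r(\varphi)$ is the supporting function of $\gamma$. Angular billiard map of $\Gamma$: let $D$ be the convex domain bounded by $\Gamma$ (oriented counterclockwise), $O\in D$, $U=\mathbb{R}^2\setminus D$. For $A\in U$ take, of the two tangent lines from $A$ to $\Gamma$, the right one as seen from $A$ looking at $\Gamma$ (the one for which the direction from $A$ to the tangency point agrees with the orientation of $\Gamma$); let $T$ be its tangency point. Let $l_A$ be the line through $O$ symmetric to the line $OA$ with respect to the line $OT$. Let $\mathcal{S}=\{A\in U: l_A\parallel AT\}$. For $A\in U\setminus\mathcal{S}$, $\mathcal{A}(A)$ is the intersection point of $l_A$ with the tangent line $AT$ ($\mathcal{A}(A)=A$ if $OA\perp OT$). The plane is identified with $\mathbb{C}$, so $re^{i\varphi}$ has polar coordinates $(r,\varphi)$. The angles are lifted so that, for $M_1\notin\Gamma$, $0<\varphi_2-\varphi_1<\pi$; the tangency point of $[M_1,M_2]$ with $\Gamma$ then has polar angle $\frac{\varphi_1+\varphi_2}{2}$. The twist condition is asserted at the pairs $(\varphi_1,\varphi_2)$ arising from points $M_1\notin\Gamma$ near $\Gamma$. *)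

theory Defs
  imports "HOL-Analysis.Analysis"
begin

definition vel :: "(real \<Rightarrow> complex) \<Rightarrow> real \<Rightarrow> complex" where
  "vel c = (\<lambda>t. vector_derivative c (at t))"

(* Signed: positive when the curve turns to the left. *)
definition curvature :: "(real \<Rightarrow> complex) \<Rightarrow> real \<Rightarrow> real" where
  "curvature c t = Im (cnj (vel c t) * vel (vel c) t) / norm (vel c t) ^ 3"

definition smooth_curve :: "(real \<Rightarrow> complex) \<Rightarrow> bool" where
  "smooth_curve c \<longleftrightarrow> (\<forall>k. (vel ^^ k) c differentiable_on UNIV)"

(* A regular, simple, counterclockwise parametrization, of period 2 pi, of a smooth convex closed
   curve of everywhere positive curvature.  The domain bounded by it is inside (range c). *)
definition smooth_convex_closed_curve :: "(real \<Rightarrow> complex) \<Rightarrow> bool" where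
  "smooth_convex_closed_curve c \<longleftrightarrow>
     smooth_curve c \<and>
     (\<forall>t. c (t + 2 * pi) = c t) \<and>
     inj_on c {0..<2 * pi} \<and>
     (\<forall>t. vel c t \<noteq> 0) \<and>
     convex (inside (range c)) \<and>
     (\<forall>t. curvature c t > 0)"

definition tangent_line :: "(real \<Rightarrow> complex) \<Rightarrow> real \<Rightarrow> complex set" where
  "tangent_line c t = {c t + s *\<^sub>R vel c t | s. True}"

definition dual_curve :: "(real \<Rightarrow> complex) \<Rightarrow> complex set" where
  "dual_curve c = {n /\<^sub>R p | n p. norm n = 1 \<and> p > 0 \<and> (\<exists>t. {X. n \<bullet> X = p} = tangent_line c t)}"

definition polar_curve :: "(real \<Rightarrow> real) \<Rightarrow> real \<Rightarrow> complex" where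
  "polar_curve r = (\<lambda>\<phi>. rcis (r \<phi>) \<phi>)"

text \<open>The angular billiard of a counterclockwise curve \<open>G\<close> around the origin. Points of the curve
  itself belong to the phase space \<open>U\<close>, as the domain bounded by \<open>G\<close> is open; such a point is its own
  tangency point (this is the case \<open>s = 0\<close> below).\<close>

definition outer_region :: "(real \<Rightarrow> complex) \<Rightarrow> complex set" where
  "outer_region G = - inside (range G)"

definition right_tangency_param :: "(real \<Rightarrow> complex) \<Rightarrow> complex \<Rightarrow> real" where
  "right_tangency_param G A =
     (THE t. 0 \<le> t \<and> t < 2 * pi \<and> (\<exists>s\<ge>0. G t = A + s *\<^sub>R vel G t))"

definition right_tangency_point :: "(real \<Rightarrow> complex) \<Rightarrow> complex \<Rightarrow> complex" where
  "right_tangency_point G A = G (right_tangency_param G A)"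

definition right_tangent_line :: "(real \<Rightarrow> complex) \<Rightarrow> complex \<Rightarrow> complex set" where
  "right_tangent_line G A = tangent_line G (right_tangency_param G A)"

definition reflect_across :: "complex \<Rightarrow> complex \<Rightarrow> complex" where
  "reflect_across T z = (2 * (z \<bullet> T) / (T \<bullet> T)) *\<^sub>R T - z"

definition reflected_line :: "(real \<Rightarrow> complex) \<Rightarrow> complex \<Rightarrow> complex set" where
  "reflected_line G A = reflect_across (right_tangency_point G A) ` span {A}"

definition singular_set :: "(real \<Rightarrow> complex) \<Rightarrow> complex set" where
  "singular_set G =
     {A \<in> outer_region G. affine_parallel (reflected_line G A) (right_tangent_line G A)}"

(* Meaningful for A in outer_region G - singular_set G. *)
definition angular_billiard :: "(real \<Rightarrow> complex) \<Rightarrow> complex \<Rightarrow> complex" where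
  "angular_billiard G A = (THE X. X \<in> reflected_line G A \<inter> right_tangent_line G A)"

definition segment_domain :: "(real \<Rightarrow> complex) \<Rightarrow> complex set" where
  "segment_domain G =
     {M \<in> outer_region G - singular_set G.
        right_tangency_point G M \<in> closed_segment M (angular_billiard G M)}"

text \<open>The differentials of \<open>1/r\<close> and of the polar angle at \<open>z \<noteq> 0\<close>. Near \<open>z\<close>, the function
  \<open>w \<mapsto> Arg (w / z)\<close> is, up to an additive constant, a smooth branch of the polar angle.\<close>

definition d_inv_radius :: "complex \<Rightarrow> complex \<Rightarrow> real" where
  "d_inv_radius z = frechet_derivative (\<lambda>w. 1 / norm w) (at z)"

definition d_angle :: "complex \<Rightarrow> complex \<Rightarrow> real" where
  "d_angle z = frechet_derivative (\<lambda>w. Arg (w / z)) (at z)"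

definition symplectic_form :: "complex \<Rightarrow> complex \<Rightarrow> complex \<Rightarrow> real" where
  "symplectic_form z u v = d_inv_radius z u * d_angle z v - d_inv_radius z v * d_angle z u"

definition preserves_symplectic_form_at :: "(complex \<Rightarrow> complex) \<Rightarrow> complex \<Rightarrow> bool" where
  "preserves_symplectic_form_at F z \<longleftrightarrow>
     (\<exists>L. (F has_derivative L) (at z) \<and>
          (\<forall>u v. symplectic_form (F z) (L u) (L v) = symplectic_form z u v))"

definition generating_function :: "(real \<Rightarrow> real) \<Rightarrow> real \<Rightarrow> real \<Rightarrow> real" where
  "generating_function r \<phi>\<^sub>1 \<phi>\<^sub>2 = 2 / r ((\<phi>\<^sub>1 + \<phi>\<^sub>2) / 2) * sin ((\<phi>\<^sub>2 - \<phi>\<^sub>1) / 2)"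

(* Lifts of the polar angles of M and of its image; on the curve, M is a fixed point. *)
definition lifted_angles :: "(real \<Rightarrow> complex) \<Rightarrow> complex \<Rightarrow> real \<Rightarrow> real \<Rightarrow> bool" where
  "lifted_angles G M \<phi>\<^sub>1 \<phi>\<^sub>2 \<longleftrightarrow>
     M = rcis (norm M) \<phi>\<^sub>1 \<and>
     angular_billiard G M = rcis (norm (angular_billiard G M)) \<phi>\<^sub>2 \<and>
     (if M \<in> range G then \<phi>\<^sub>2 = \<phi>\<^sub>1 else 0 < \<phi>\<^sub>2 - \<phi>\<^sub>1 \<and> \<phi>\<^sub>2 - \<phi>\<^sub>1 < pi)"

(* The mixed derivative of S, first in the second argument and then in the first, is positive. *)
definition twist_condition_at :: "(real \<Rightarrow> real \<Rightarrow> real) \<Rightarrow> real \<Rightarrow> real \<Rightarrow> bool" where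
  "twist_condition_at S \<phi>\<^sub>1 \<phi>\<^sub>2 \<longleftrightarrow>
     (\<exists>S\<^sub>2 d. (\<forall>\<^sub>F x in nhds \<phi>\<^sub>1. (S x has_real_derivative S\<^sub>2 x) (at \<phi>\<^sub>2)) \<and>
             (S\<^sub>2 has_real_derivative d) (at \<phi>\<^sub>1) \<and> d > 0)"

end

theory Submission
  imports Defs
begin

text \<open>Put \<open>p = 1 / r\<close>. The line tangent to \<open>\<Gamma>\<close> at the point of polar angle \<open>t\<close> has the polar equation
\<open>1 / \<rho> = p t * cos (t - \<theta>) - p' t * sin (t - \<theta>)\<close>: the lines that avoid \<open>O\<close> are the curves whose inverse
radius is a combination of \<open>cos \<theta>\<close> and \<open>sin \<theta>\<close>, and this combination agrees with \<open>p \<theta>\<close> to first order at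
\<open>\<theta> = t\<close>. Writing \<open>d = t - \<theta>\<close>, the inverse radius on the line is \<open>inv_dist t d = p t * cos d - p' t * sin d\<close>.

Reflection in the line through \<open>O\<close> of polar angle \<open>t\<close> replaces \<open>\<theta> = t - d\<close> by \<open>t + d\<close>. If a point outside \<open>\<Gamma>\<close>
is described by the pair \<open>(t, d)\<close>, where \<open>t\<close> belongs to its right tangency point, then its image under
the angular billiard is described in the same way by \<open>(t, - d)\<close>. Everything follows from this:

  \<^item> \<open>d(1/\<rho>) \<and> d\<theta>\<close> becomes \<open>(p t + p'' t) * sin d dt \<and> dd\<close>, which \<open>d \<mapsto> - d\<close> preserves.

  \<^item> With \<open>m = (\<phi>\<^sub>1 + \<phi>\<^sub>2) / 2\<close> and \<open>\<delta> = (\<phi>\<^sub>2 - \<phi>\<^sub>1) / 2\<close> the generating function is \<open>2 * p m * sin \<delta>\<close>. Its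
    partial derivatives are \<open>- inv_dist m \<delta>\<close> and \<open>inv_dist m (- \<delta>)\<close>, the negative inverse radius of
    \<open>M\<^sub>1\<close> and the inverse radius of \<open>M\<^sub>2\<close>, and its mixed derivative is \<open>(p m + p'' m) * sin \<delta> / 2\<close>.

Positive curvature of \<open>\<Gamma>\<close> means \<open>p + p'' > 0\<close>. Along a fixed ray \<open>\<theta>\<close> the derivative of
\<open>inv_dist (\<theta> + d) d\<close> in \<open>d\<close> is \<open>- (p + p'') * sin d\<close>, so that the right tangency point exists and is
unique (\<open>exists_tangency\<close>, \<open>cis_right_tangency_param\<close>), and it is close to the ray when the point is
close to \<open>\<Gamma>\<close> (\<open>segment_domain_near_curve\<close>). The segment condition amounts to \<open>inv_dist t (- d) > 0\<close>
(\<open>segment_domain_iff\<close>). The inverse function theorem makes \<open>(t, d)\<close> differentiable functions of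
the point, which turns the computation with the form into a statement about the derivative of the
billiard map (\<open>preserves_symplectic_form_chart\<close>).\<close>

section \<open>Angles modulo the period\<close>

lemma cis_eq_cis_iff: "cis a = cis b \<longleftrightarrow> (\<exists>k::int. a = b + 2 * pi * k)"
  using sin_cos_eq_iff[of a b] by (auto simp: complex_eq_iff)

lemma cis_inj_period:
  assumes "cis s = cis t" "\<bar>s - t\<bar> < 2 * pi"
  shows "s = t"
proof -
  obtain k :: int where k: "s = t + 2 * pi * k"
    using assms(1) by (auto simp: cis_eq_cis_iff)
  with assms(2) have "2 * pi * \<bar>real_of_int k\<bar> < 2 * pi * 1"
    by (simp add: abs_mult)
  then have "k = 0"
    by (subst (asm) mult_less_cancel_left_pos) auto
  with k show ?thesis by simp
qed

lemma obtain_cis_period: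
  obtains t where "0 \<le> t" "t < 2 * pi" "cis t = cis x"
proof
  show "0 \<le> Arg2pi (cis x)" "Arg2pi (cis x) < 2 * pi"
    by (rule Arg2pi_ge_0, rule Arg2pi_lt_2pi)
  show "cis (Arg2pi (cis x)) = cis x"
    using Arg2pi_eq[of "cis x"] by (simp add: cis_conv_exp)
qed

lemma rcis_pos_eq_iff:
  assumes "a > 0" "b > 0"
  shows "rcis a x = rcis b y \<longleftrightarrow> a = b \<and> cis x = cis y"
proof
  assume eq: "rcis a x = rcis b y"
  then have "a = b"
    using assms by (metis abs_of_pos complex_mod_rcis)
  with eq assms show "a = b \<and> cis x = cis y"
    by (simp add: rcis_def)
qed (simp add: rcis_def)

lemma periodic_int_shift:
  fixes f :: "real \<Rightarrow> 'a"
  assumes "\<And>x. f (x + c) = f x"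
  shows "f (x + c * of_int k) = f x"
proof -
  have nat: "f (y + c * real n) = f y" for n y
  proof (induction n)
    case (Suc n)
    then show ?case
      using assms[of "y + c * real n"] by (simp add: algebra_simps)
  qed simp
  show ?thesis
  proof (cases "k \<ge> 0")
    case True
    then show ?thesis using nat[of x "nat k"] by simp
  next
    case False
    then show ?thesis using nat[of "x + c * of_int k" "nat (- k)"] by simp
  qed
qed

lemma periodic_cis_cong:
  fixes f :: "real \<Rightarrow> 'a"
  assumes "\<And>x. f (x + 2 * pi) = f x" and "cis x = cis y"
  shows "f x = f y"
  using assms(2) periodic_int_shift[of f "2 * pi" y, OF assms(1)]
  by (auto simp: cis_eq_cis_iff)

lemma DERIV_periodic:
  fixes f f' :: "real \<Rightarrow> real"
  assumes "\<And>x. (f has_real_derivative f' x) (at x)" and per: "\<And>x. f (x + c) = f x"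
  shows "f' (x + c) = f' x"
proof -
  have "((\<lambda>y. f (y + c)) has_real_derivative f' (x + c)) (at x)"
    using assms(1)[of "x + c"] by (subst (asm) DERIV_shift)
  then show ?thesis
    using assms(1)[of x] by (simp add: per DERIV_unique)
qed

text \<open>Periodicity hides the jump of the argument: near a point \<open>z0\<close>, \<open>Arg z\<close> can be replaced by the
continuous branch \<open>Arg z0 + Arg (z / z0)\<close>, which differs from it by a multiple of \<open>2 * pi\<close>.\<close>

lemma continuous_on_periodic_Arg:
  fixes f :: "real \<Rightarrow> real"
  assumes "\<And>x. isCont f x" and per: "\<And>x. f (x + 2 * pi) = f x"
  shows "continuous_on (- {0}) (\<lambda>z. f (Arg z))"
proof (rule continuous_at_imp_continuous_on, rule ballI)
  fix z0 :: complex assume "z0 \<in> - {0}"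
  then have z0: "z0 \<noteq> 0" by simp
  have "isCont Arg (z0 / z0)"
    using z0 by (intro continuous_at_Arg) simp
  moreover have "isCont (\<lambda>z. z / z0) z0"
    using z0 by (intro continuous_intros) simp
  ultimately have "isCont (\<lambda>z. Arg (z / z0)) z0"
    using isCont_o2[of z0 "\<lambda>z. z / z0" Arg] by blast
  then have "isCont (\<lambda>z. Arg z0 + Arg (z / z0)) z0"
    by (intro continuous_intros)
  then have cont: "isCont (\<lambda>z. f (Arg z0 + Arg (z / z0))) z0"
    using isCont_o2[of z0 "\<lambda>z. Arg z0 + Arg (z / z0)" f] assms(1) by blast
  have "\<forall>\<^sub>F z in nhds z0. f (Arg z0 + Arg (z / z0)) = f (Arg z)"
    using t1_space_nhds[OF z0]
  proof eventually_elim
    case (elim z)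
    have "cis (Arg z0 + Arg (z / z0)) = cis (Arg z)"
      using z0 elim by (simp flip: cis_mult add: cis_Arg sgn_zero_iff)
    then show ?case
      by (rule periodic_cis_cong[of f, OF per])
  qed
  then show "isCont (\<lambda>z. f (Arg z)) z0"
    using cont by (simp add: isCont_cong)
qed

section \<open>The symplectic form in polar coordinates\<close>

text \<open>With \<open>h / z\<close> the logarithmic differential, \<open>d(1/r) = - Re (h / z) / norm z\<close> and \<open>d\<phi> = Im (h / z)\<close>. Their
wedge product is the area form divided by the cube of the radius.\<close>

lemma symplectic_form_eq:
  assumes "z \<noteq> 0"
  shows "symplectic_form z u v = Im (u * cnj v) / norm z ^ 3"
proof -
  have "((\<lambda>w. 1 / norm w) has_derivative (\<lambda>h. - (z \<bullet> h) / norm z ^ 3)) (at z)"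
    using assms
    by (auto intro!: derivative_eq_intros has_derivative_norm
        simp: sgn_div_norm field_simps power2_eq_square power3_eq_cube inner_commute)
  then have r: "d_inv_radius z = (\<lambda>h. - (z \<bullet> h) / norm z ^ 3)"
    unfolding d_inv_radius_def using frechet_derivative_at by metis
  have "((\<lambda>w. Ln (w / z)) has_field_derivative 1 / z) (at z)"
    using assms by (auto intro!: derivative_eq_intros)
  then have "((\<lambda>w. Im (Ln (w / z))) has_derivative (\<lambda>h. Im (1 / z * h))) (at z)"
    unfolding has_field_derivative_def by (intro bounded_linear.has_derivative[OF bounded_linear_Im])
  then have "((\<lambda>w. Arg (w / z)) has_derivative (\<lambda>h. Im (1 / z * h))) (at z)"
    by (rule has_derivative_transform_within_open[of _ _ _ _ "- {0}"])
      (use assms in \<open>auto simp: Arg_eq_Im_Ln\<close>)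
  then have a: "d_angle z = (\<lambda>h. Im (1 / z * h))"
    unfolding d_angle_def using frechet_derivative_at by metis
  have sq: "Im (1 / z * h) = Im (h * cnj z) / norm z ^ 2" for h
    by (simp only: complex_div_cnj[of h z] times_divide_eq_left mult_1 Im_divide_of_real flip: of_real_power)
  have "symplectic_form z u v
      = ((z \<bullet> v) * Im (u * cnj z) - (z \<bullet> u) * Im (v * cnj z)) / (norm z ^ 3 * norm z ^ 2)"
    unfolding symplectic_form_def r a sq by (simp only: times_divide_times_eq minus_divide_left
        diff_divide_distrib mult_minus_left minus_mult_commute mult.commute[of "norm z ^ 3"])
  also have "(z \<bullet> v) * Im (u * cnj z) - (z \<bullet> u) * Im (v * cnj z) = norm z ^ 2 * Im (u * cnj v)"
    unfolding cmod_power2 inner_complex_def by (simp add: algebra_simps power2_eq_square)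
  also have "\<dots> / (norm z ^ 3 * norm z ^ 2) = Im (u * cnj v) / norm z ^ 3"
    using assms by (simp add: divide_simps eval_nat_numeral)
  finally show ?thesis .
qed

text \<open>As a multiple of the point the derivative has no trigonometric functions left: the multiplier is the
logarithmic derivative, with radial part \<open>- \<beta> / u\<close> and angular part \<open>\<alpha>\<close>.\<close>

lemma has_derivative_polar:
  fixes u a :: "'a::real_normed_vector \<Rightarrow> real"
  assumes "(u has_derivative \<beta>) (at x)" "(a has_derivative \<alpha>) (at x)" "u x \<noteq> 0"
  shows "((\<lambda>x. rcis (1 / u x) (a x)) has_derivative
    (\<lambda>k. rcis (1 / u x) (a x) * Complex (- \<beta> k / u x) (\<alpha> k))) (at x)"
proof -
  have "((\<lambda>x. 1 / u x) has_derivative (\<lambda>k. - \<beta> k / u x ^ 2)) (at x)"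
    using assms by (auto intro!: derivative_eq_intros simp: power2_eq_square field_simps)
  then have "((\<lambda>x. complex_of_real (1 / u x) * cis (a x)) has_derivative
      (\<lambda>k. complex_of_real (1 / u x) * (\<alpha> k *\<^sub>R (\<i> * cis (a x))) + complex_of_real (- \<beta> k / u x ^ 2) * cis (a x))) (at x)"
    by (intro has_derivative_mult has_derivative_of_real has_derivative_cis assms)
  then show ?thesis
    unfolding rcis_def
    by (rule has_derivative_eq_rhs)
      (auto simp: fun_eq_iff complex_eq_iff power2_eq_square diff_divide_distrib field_simps)
qed

lemma symplectic_form_polar:
  assumes "u > 0"
  shows "symplectic_form (rcis (1 / u) a) (rcis (1 / u) a * Complex (- b / u) s)
    (rcis (1 / u) a * Complex (- b' / u) s') = b * s' - b' * s"
proof -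
  let ?z = "rcis (1 / u) a" and ?x = "Complex (- b / u) s" and ?y = "Complex (- b' / u) s'"
  have zz: "?z * cnj ?z = complex_of_real ((1 / u) ^ 2)"
    by (simp add: rcis_def cis_cnj cis_mult power2_eq_square)
  have "Im (?z * ?x * cnj (?z * ?y)) = Im ((?z * cnj ?z) * (?x * cnj ?y))"
    by (simp add: mult_ac)
  also have "\<dots> = (1 / u) ^ 2 * Im (?x * cnj ?y)"
    unfolding zz by simp
  also have "\<dots> / norm ?z ^ 3 = b * s' - b' * s"
    using assms by (simp add: field_simps eval_nat_numeral)
  finally show ?thesis
    using assms by (simp add: symplectic_form_eq)
qed

section \<open>Tangent lines of a polar curve\<close>

text \<open>The setting is the polar curve \<open>r = 1 / p\<close>. The envelope of the lines \<open>{X. cis t \<bullet> X = p t}\<close> is the dual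
curve, whose radius of curvature is \<open>p + p''\<close>.\<close>

locale support_function =
  fixes p p' p'' :: "real \<Rightarrow> real"
  assumes deriv_p: "(p has_real_derivative p' t) (at t)"
    and deriv_p': "(p' has_real_derivative p'' t) (at t)"
    and p_pos: "p t > 0"
    and curv_pos: "p t + p'' t > 0"
    and periodic: "p (t + 2 * pi) = p t"
begin

abbreviation curve :: "real \<Rightarrow> complex" where
  "curve \<equiv> polar_curve (\<lambda>t. 1 / p t)"

text \<open>The inverse radius, on the line tangent to the curve at polar angle \<open>t\<close>, of the point of polar
angle \<open>t - d\<close>; it is negative on the rays opposite to those that meet the line.\<close>

definition inv_dist :: "real \<Rightarrow> real \<Rightarrow> real" where
  "inv_dist t d = p t * cos d - p' t * sin d"

lemma p'_periodic: "p' (t + 2 * pi) = p' t"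
  by (rule DERIV_periodic[of p, OF deriv_p periodic])

lemma curve_periodic: "curve (t + 2 * pi) = curve t"
  by (simp add: polar_curve_def rcis_def periodic complex_eq_iff)

lemma p_cong: "cis s = cis t \<Longrightarrow> p s = p t"
  by (rule periodic_cis_cong[of p, OF periodic])

lemma inv_dist_cong:
  assumes "cis s = cis t" "cis d = cis e"
  shows "inv_dist s d = inv_dist t e"
  using p_cong[OF assms(1)] periodic_cis_cong[of p', OF p'_periodic assms(1)] assms(2)
  by (simp add: inv_dist_def complex_eq_iff)

lemma inv_dist_0 [simp]: "inv_dist t 0 = p t"
  by (simp add: inv_dist_def)

lemma inv_dist_add: "inv_dist t d + inv_dist t (- d) = 2 * p t * cos d"
  by (simp add: inv_dist_def)

lemma isCont_p: "isCont p t" and isCont_p': "isCont p' t"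
  using deriv_p deriv_p' DERIV_isCont by blast+

lemma has_derivative_inv_dist:
  fixes a b :: "'a::real_normed_vector \<Rightarrow> real"
  assumes "(a has_derivative a') (at x)" "(b has_derivative b') (at x)"
  shows "((\<lambda>x. inv_dist (a x) (b x)) has_derivative
    (\<lambda>h. a' h * (p' (a x) * cos (b x) - p'' (a x) * sin (b x))
        - b' h * (p (a x) * sin (b x) + p' (a x) * cos (b x)))) (at x)"
proof -
  have [derivative_intros]: "((\<lambda>x. p (a x)) has_derivative (\<lambda>h. a' h * p' (a x))) (at x)"
    "((\<lambda>x. p' (a x)) has_derivative (\<lambda>h. a' h * p'' (a x))) (at x)"
    using DERIV_compose_FDERIV deriv_p deriv_p' assms(1) by blast+
  show ?thesis
    unfolding inv_dist_def using assms
    by (auto intro!: derivative_eq_intros simp: algebra_simps fun_eq_iff)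
qed

lemma continuous_on_inv_dist:
  fixes f g :: "'a::t2_space \<Rightarrow> real"
  assumes "continuous_on S f" "continuous_on S g"
  shows "continuous_on S (\<lambda>x. inv_dist (f x) (g x))"
proof -
  have "continuous_on S (\<lambda>x. p (f x))" "continuous_on S (\<lambda>x. p' (f x))"
    using isCont_p isCont_p' by (auto intro!: continuous_on_compose2[OF _ assms(1)]
        continuous_at_imp_continuous_on[of UNIV])
  with assms show ?thesis
    unfolding inv_dist_def by (intro continuous_intros)
qed

text \<open>Here the ray \<open>\<theta>\<close> is fixed and the tangent line turns. The factor \<open>sin d\<close> reflects that infinitesimally
near tangent lines meet on the curve, that is, on the ray with \<open>d = 0\<close>.\<close>

lemma deriv_inv_dist_diagonal:
  "((\<lambda>d. inv_dist (\<theta> + d) d) has_real_derivative - (p (\<theta> + d) + p'' (\<theta> + d)) * sin d) (at d)"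
  unfolding has_field_derivative_def
  by (rule has_derivative_eq_rhs[OF has_derivative_inv_dist[where a' = "\<lambda>h. h" and b' = "\<lambda>h. h"]])
    (auto intro!: derivative_eq_intros simp: algebra_simps)

lemma inv_dist_strict_decreasing:
  assumes "0 \<le> a" "a < b" "b \<le> pi"
  shows "inv_dist (\<theta> + b) b < inv_dist (\<theta> + a) a"
proof (rule DERIV_neg_imp_decreasing_open[OF assms(2)])
  fix x assume "a < x" "x < b"
  then have "sin x > 0" using assms by (intro sin_gt_zero) auto
  then show "\<exists>y. DERIV (\<lambda>d. inv_dist (\<theta> + d) d) x :> y \<and> y < 0"
    using deriv_inv_dist_diagonal[of \<theta> x] curv_pos[of "\<theta> + x"]
    by (meson mult_neg_pos neg_less_0_iff_less)
qed (intro continuous_on_inv_dist continuous_intros)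

lemma inv_dist_at_pi: "inv_dist t pi < 0"
  using p_pos[of t] by (simp add: inv_dist_def)

lemma inv_dist_inject:
  assumes "0 \<le> a" "a \<le> pi" "0 \<le> b" "b \<le> pi" "inv_dist (\<theta> + a) a = inv_dist (\<theta> + b) b"
  shows "a = b"
  using inv_dist_strict_decreasing[of a b \<theta>] inv_dist_strict_decreasing[of b a \<theta>] assms
  by (cases a b rule: linorder_cases) auto

lemma inv_dist_lt_pi:
  assumes "0 \<le> d" "d \<le> pi" "inv_dist t d > 0"
  shows "d < pi"
  using assms inv_dist_at_pi[of t] by (cases "d = pi") auto

text \<open>The condition \<open>u \<le> p \<theta>\<close> says that the point of inverse radius \<open>u\<close> on the ray \<open>\<theta>\<close> is not inside. As
the tangent line turns from \<open>\<theta>\<close> to \<open>\<theta> + pi\<close>, its inverse radius on the ray falls from \<open>p \<theta>\<close> to a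
negative value, and passes \<open>u\<close> on the way.\<close>

lemma exists_tangency:
  assumes "0 < u" "u \<le> p \<theta>"
  obtains d where "0 \<le> d" "d < pi" "inv_dist (\<theta> + d) d = u"
proof -
  have "\<exists>d\<ge>0. d \<le> pi \<and> inv_dist (\<theta> + d) d = u"
    using assms inv_dist_at_pi[of "\<theta> + pi"]
    by (intro IVT2') (auto intro!: continuous_on_inv_dist continuous_intros)
  then obtain d where d: "0 \<le> d" "d \<le> pi" "inv_dist (\<theta> + d) d = u"
    by blast
  with assms(1) show thesis
    by (intro that[of d] inv_dist_lt_pi[of d "\<theta> + d"]) auto
qed

lemma vel_curve: "vel curve t = Complex (- p' t) (p t) / p t ^ 2 * cis t"
proof -
  have "((\<lambda>t. complex_of_real (1 / p t)) has_vector_derivative complex_of_real (- p' t / p t ^ 2)) (at t)"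
    by (intro has_vector_derivative_of_real)
      (auto intro!: derivative_eq_intros deriv_p simp: p_pos[THEN less_imp_neq, symmetric] power2_eq_square)
  moreover have "(cis has_vector_derivative \<i> * cis t) (at t)"
    unfolding has_vector_derivative_def
    by (rule has_derivative_eq_rhs[OF has_derivative_cis[OF has_derivative_ident]])
      (simp add: scaleR_conv_of_real mult_ac)
  ultimately have "(curve has_vector_derivative
      complex_of_real (1 / p t) * (\<i> * cis t) + complex_of_real (- p' t / p t ^ 2) * cis t) (at t)"
    unfolding polar_curve_def rcis_def by (rule has_vector_derivative_mult)
  then have "vel curve t =
      complex_of_real (1 / p t) * (\<i> * cis t) + complex_of_real (- p' t / p t ^ 2) * cis t"
    unfolding vel_def by (rule vector_derivative_at)
  also have "\<dots> = (Complex (- p' t) (p t) / p t ^ 2) * cis t"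
    using p_pos[of t] by (simp add: complex_eq_iff field_simps power2_eq_square)
  finally show ?thesis .
qed

text \<open>After rotation by \<open>- t\<close> the tangent line is \<open>1 / p t + s * (- p' t + \<i> * p t) / p t ^ 2\<close>; the imaginary
part of the equation determines \<open>s\<close>, the real part is then the polar equation of the line.\<close>

lemma tangent_line_rcis_iff:
  "rcis \<sigma> \<psi> = curve t + s *\<^sub>R vel curve t \<longleftrightarrow>
     s = - \<sigma> * p t * sin (t - \<psi>) \<and> \<sigma> * inv_dist t (t - \<psi>) = 1"
proof -
  have p: "p t > 0" by (rule p_pos)
  have "rcis \<sigma> \<psi> = curve t + s *\<^sub>R vel curve t \<longleftrightarrow>
      rcis \<sigma> \<psi> * cis (- t) = (curve t + s *\<^sub>R vel curve t) * cis (- t)"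
    by simp
  also have "rcis \<sigma> \<psi> * cis (- t) = rcis \<sigma> (\<psi> - t)"
    by (simp add: rcis_def cis_mult)
  also have "(curve t + s *\<^sub>R vel curve t) * cis (- t) = 1 / p t + s *\<^sub>R (Complex (- p' t) (p t) / p t ^ 2)"
  proof -
    have "curve t * cis (- t) = 1 / p t"
      by (simp add: polar_curve_def rcis_def cis_mult)
    moreover have "vel curve t * cis (- t) = Complex (- p' t) (p t) / p t ^ 2"
      by (simp add: vel_curve mult.assoc cis_mult)
    ultimately show ?thesis by (simp add: distrib_right)
  qed
  also have "rcis \<sigma> (\<psi> - t) = \<dots> \<longleftrightarrow>
      \<sigma> * cos (t - \<psi>) = 1 / p t - s * p' t / p t ^ 2 \<and> - (\<sigma> * sin (t - \<psi>)) = s / p t"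
    using p cos_minus[of "t - \<psi>"] sin_minus[of "t - \<psi>"]
    by (simp add: complex_eq_iff power2_eq_square)
  also have "\<dots> \<longleftrightarrow> s = - \<sigma> * p t * sin (t - \<psi>) \<and> \<sigma> * inv_dist t (t - \<psi>) = 1"
    (is "?X \<and> ?Y \<longleftrightarrow> ?Z \<and> ?W")
  proof -
    have 1: "?Y \<longleftrightarrow> ?Z" using p by (auto simp: field_simps)
    have "?X \<longleftrightarrow> ?W" if ?Z
      unfolding that inv_dist_def using p by (simp add: field_simps power2_eq_square)
    with 1 show ?thesis by blast
  qed
  finally show ?thesis .
qed

lemma rcis_mem_tangent_line_iff:
  "rcis \<sigma> \<psi> \<in> tangent_line curve t \<longleftrightarrow> \<sigma> * inv_dist t (t - \<psi>) = 1"
  using tangent_line_rcis_iff unfolding tangent_line_def by auto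

lemma right_tangency_iff:
  assumes "\<rho> > 0"
  shows "(\<exists>s\<ge>0. curve t = rcis \<rho> \<theta> + s *\<^sub>R vel curve t) \<longleftrightarrow>
    sin (t - \<theta>) \<ge> 0 \<and> \<rho> * inv_dist t (t - \<theta>) = 1"
proof -
  have "curve t = rcis \<rho> \<theta> + s *\<^sub>R vel curve t \<longleftrightarrow>
      s = \<rho> * p t * sin (t - \<theta>) \<and> \<rho> * inv_dist t (t - \<theta>) = 1" for s
    using tangent_line_rcis_iff[of \<rho> \<theta> t "- s"] by (auto simp: algebra_simps)
  moreover have "\<rho> * p t * sin (t - \<theta>) \<ge> 0 \<longleftrightarrow> sin (t - \<theta>) \<ge> 0"
    using mult_le_cancel_left_pos[OF mult_pos_pos[OF assms p_pos[of t]], of 0 "sin (t - \<theta>)"]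
    by (simp only: mult_zero_right)
  ultimately show ?thesis
    by auto
qed

text \<open>The point \<open>rcis \<rho> \<theta>\<close> lies on the tangent at polar angle \<open>\<theta> + d\<close>. The bounds on \<open>d\<close> single out
the right one of the two tangents.\<close>

definition tangency_angle :: "real \<Rightarrow> real \<Rightarrow> real \<Rightarrow> bool" where
  "tangency_angle \<rho> \<theta> d \<longleftrightarrow> \<rho> > 0 \<and> 0 \<le> d \<and> d < pi \<and> \<rho> * inv_dist (\<theta> + d) d = 1"

lemma tangency_angle_inv_dist:
  assumes "tangency_angle \<rho> \<theta> d"
  shows "inv_dist (\<theta> + d) d = 1 / \<rho>" and "\<rho> > 0"
  using assms unfolding tangency_angle_def by (auto simp: eq_divide_eq mult.commute)

lemma tangency_angle_unique:
  assumes "tangency_angle \<rho> \<theta> d" "tangency_angle \<rho> \<theta>' d'" "cis \<theta> = cis \<theta>'"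
  shows "d = d'"
proof (rule inv_dist_inject[of d d' \<theta>])
  have "cis (\<theta> + d') = cis (\<theta>' + d')"
    using assms(3) by (simp flip: cis_mult)
  then have "inv_dist (\<theta> + d') d' = inv_dist (\<theta>' + d') d'"
    by (rule inv_dist_cong) simp
  then show "inv_dist (\<theta> + d) d = inv_dist (\<theta> + d') d'"
    using assms(1,2) unfolding tangency_angle_def by (metis less_irrefl mult_left_cancel)
qed (use assms in \<open>auto simp: tangency_angle_def\<close>)

text \<open>The definite description fixes a parameter in \<open>{0..<2 * pi}\<close>, whereas \<open>\<theta> + d\<close> is any lift of the
angle; hence the equality holds only up to the period. Of the angles modulo the period, those with
\<open>sin d < 0\<close> belong to left tangents, and on \<open>{0..pi}\<close> monotonicity leaves a single one.\<close>

lemma cis_right_tangency_param: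
  assumes "tangency_angle \<rho> \<theta> d"
  shows "cis (right_tangency_param curve (rcis \<rho> \<theta>)) = cis (\<theta> + d)"
proof -
  from assms have \<rho>: "\<rho> > 0" and d: "0 \<le> d" "d < pi" and e: "\<rho> * inv_dist (\<theta> + d) d = 1"
    by (auto simp: tangency_angle_def)
  let ?P = "\<lambda>t. sin (t - \<theta>) \<ge> 0 \<and> \<rho> * inv_dist t (t - \<theta>) = 1"
  have P_imp: "cis t = cis (\<theta> + d)" if "?P t" for t
  proof -
    obtain d' where d': "0 \<le> d'" "d' < 2 * pi" "cis d' = cis (t - \<theta>)"
      by (rule obtain_cis_period[of "t - \<theta>"])
    have t: "cis t = cis (\<theta> + d')"
      using d'(3) by (simp flip: cis_mult add: cis_divide[symmetric])
    have e': "\<rho> * inv_dist (\<theta> + d') d' = 1"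
      using that inv_dist_cong[OF t d'(3)[symmetric]] by simp
    have "sin d' \<ge> 0"
      using that d'(3) by (simp add: complex_eq_iff)
    then have "d' \<le> pi"
      using d' sin_lt_zero[of d'] by force
    moreover have "inv_dist (\<theta> + d') d' = inv_dist (\<theta> + d) d"
      using e e' \<rho> by (metis mult_left_cancel less_irrefl)
    ultimately have "d' = d"
      using d d' by (intro inv_dist_inject[of d' d \<theta>]) auto
    with t show ?thesis by simp
  qed
  have ex: "\<exists>!t. 0 \<le> t \<and> t < 2 * pi \<and> ?P t"
  proof -
    obtain t where t: "0 \<le> t" "t < 2 * pi" "cis t = cis (\<theta> + d)"
      by (rule obtain_cis_period[of "\<theta> + d"])
    have td: "cis (t - \<theta>) = cis d"
      using t(3) by (simp flip: cis_divide cis_mult)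
    have "sin (t - \<theta>) \<ge> 0"
      using td d sin_ge_zero[of d] by (simp add: complex_eq_iff)
    moreover have "\<rho> * inv_dist t (t - \<theta>) = 1"
      using e inv_dist_cong[OF t(3) td] by simp
    moreover have "s = t" if "0 \<le> s" "s < 2 * pi" "?P s" for s
    proof -
      have "cis s = cis t" using P_imp[OF that(3)] t(3) by simp
      then show ?thesis
        using that t by (intro cis_inj_period) auto
    qed
    ultimately show ?thesis using t by blast
  qed
  have "?P (right_tangency_param curve (rcis \<rho> \<theta>))"
    unfolding right_tangency_param_def right_tangency_iff[OF \<rho>]
    using theI'[OF ex] by blast
  then show ?thesis by (rule P_imp)
qed

end

section \<open>The angular billiard in terms of the tangency angle\<close>

lemma reflect_across_rcis:
  assumes "a \<noteq> 0"
  shows "reflect_across (rcis a m) (rcis k \<psi>) = rcis k (2 * m - \<psi>)"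
proof -
  define \<alpha> where "\<alpha> = \<psi> - m"
  have [simp]: "\<psi> = m + \<alpha>" "2 * m - (m + \<alpha>) = m - \<alpha>"
    by (simp_all add: \<alpha>_def)
  have TT: "rcis a m \<bullet> rcis a m = a\<^sup>2"
    by (simp add: dot_square_norm)
  have "rcis k \<psi> \<bullet> rcis a m = k * a * (cos (m + \<alpha>) * cos m + sin (m + \<alpha>) * sin m)"
    by (simp add: inner_complex_def algebra_simps)
  also have "cos (m + \<alpha>) * cos m + sin (m + \<alpha>) * sin m = cos \<alpha>"
    using cos_diff[of "m + \<alpha>" m] by simp
  finally have "2 * (rcis k \<psi> \<bullet> rcis a m) / (rcis a m \<bullet> rcis a m) = 2 * k * cos \<alpha> / a"
    using assms unfolding TT by (simp add: power2_eq_square)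
  then show ?thesis
    using assms by (simp add: reflect_across_def complex_eq_iff cos_add cos_diff sin_add sin_diff algebra_simps)
qed

context support_function
begin

lemma curve_cong: "cis s = cis t \<Longrightarrow> curve s = curve t"
  by (rule periodic_cis_cong[of curve, OF curve_periodic])

lemma tangent_line_cong: "cis s = cis t \<Longrightarrow> tangent_line curve s = tangent_line curve t"
  using p_cong[of s t] periodic_cis_cong[of p' s t, OF p'_periodic] curve_cong[of s t]
  by (simp add: tangent_line_def vel_curve)

lemma rcis_on_curve_iff:
  assumes "\<rho> > 0"
  shows "rcis \<rho> \<theta> \<in> range curve \<longleftrightarrow> \<rho> * p \<theta> = 1"
proof
  assume "rcis \<rho> \<theta> \<in> range curve"
  then obtain t where "rcis \<rho> \<theta> = rcis (1 / p t) t"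
    by (auto simp: polar_curve_def)
  then have "\<rho> = 1 / p t" "cis \<theta> = cis t"
    using assms p_pos[of t] by (auto simp: rcis_pos_eq_iff)
  then show "\<rho> * p \<theta> = 1"
    using p_cong[of \<theta> t] p_pos[of t] by simp
next
  assume "\<rho> * p \<theta> = 1"
  then have "\<rho> = 1 / p \<theta>"
    using p_pos[of \<theta>] by (simp add: eq_divide_eq)
  then have "rcis \<rho> \<theta> = curve \<theta>"
    by (simp add: polar_curve_def)
  then show "rcis \<rho> \<theta> \<in> range curve" by blast
qed

lemma tangency_angle_0_iff:
  assumes "tangency_angle \<rho> \<theta> d"
  shows "rcis \<rho> \<theta> \<in> range curve \<longleftrightarrow> d = 0"
proof -
  have \<rho>: "\<rho> > 0" and d: "0 \<le> d" "d < pi" and e: "\<rho> * inv_dist (\<theta> + d) d = 1"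
    using assms by (auto simp: tangency_angle_def)
  have "d = 0" if "\<rho> * p \<theta> = 1"
  proof (rule inv_dist_inject[of d 0 \<theta>])
    show "inv_dist (\<theta> + d) d = inv_dist (\<theta> + 0) 0"
      using that e \<rho> by (metis add.right_neutral inv_dist_0 less_irrefl mult_left_cancel)
  qed (use d in auto)
  with e show ?thesis
    by (auto simp: rcis_on_curve_iff[OF \<rho>])
qed

text \<open>The points with \<open>\<rho> * p \<theta> < 1\<close> are joined to the origin by a segment that misses the curve, so they
lie in the component of the origin.\<close>

lemma outside_gauge:
  assumes "0 \<in> inside (range curve)" "rcis \<rho> \<theta> \<in> outer_region curve" "\<rho> \<ge> 0"
  shows "\<rho> * p \<theta> \<ge> 1"
proof (rule ccontr)
  assume "\<not> \<rho> * p \<theta> \<ge> 1"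
  have "closed_segment 0 (rcis \<rho> \<theta>) \<subseteq> - range curve"
  proof
    fix z assume "z \<in> closed_segment 0 (rcis \<rho> \<theta>)"
    then obtain l where l: "0 \<le> l" "l \<le> 1" "z = rcis (l * \<rho>) \<theta>"
      by (auto simp: in_segment rcis_def scaleR_conv_of_real)
    show "z \<in> - range curve"
    proof (cases "l * \<rho> > 0")
      case True
      have "l * \<rho> * p \<theta> \<le> 1 * \<rho> * p \<theta>"
        using l assms(3) p_pos[of \<theta>] by (intro mult_right_mono) auto
      with \<open>\<not> \<rho> * p \<theta> \<ge> 1\<close> show ?thesis
        unfolding l(3) by (simp add: rcis_on_curve_iff[OF True])
    next
      case False
      then have "l * \<rho> = 0"
        using mult_nonneg_nonneg[OF l(1) assms(3)] by linarith
      then have "z = 0"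
        unfolding l(3) by simp
      moreover have "0 \<notin> range curve"
        using assms(1) by (simp add: inside_def)
      ultimately show ?thesis by (simp del: image_iff)
    qed
  qed
  then have "connected_component (- range curve) 0 (rcis \<rho> \<theta>)"
    by (intro connected_componentI[OF connected_segment]) auto
  from inside_same_component[OF this assms(1)] assms(2) show False
    by (simp add: outer_region_def)
qed

lemma outer_point_tangency:
  assumes "0 \<in> inside (range curve)" "M \<in> outer_region curve" "M = rcis (norm M) \<theta>"
  obtains d where "tangency_angle (norm M) \<theta> d"
proof -
  have g: "norm M * p \<theta> \<ge> 1"
    using outside_gauge[of "norm M" \<theta>] assms by simp
  then have \<rho>: "norm M > 0"
    by (cases "M = 0") auto
  obtain d where "0 \<le> d" "d < pi" "inv_dist (\<theta> + d) d = 1 / norm M"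
    using exists_tangency[of "1 / norm M" \<theta>] g \<rho> by (auto simp: field_simps)
  with \<rho> show thesis
    by (intro that[of d]) (auto simp: tangency_angle_def)
qed

lemma right_tangency:
  assumes "tangency_angle \<rho> \<theta> d"
  shows "right_tangency_point curve (rcis \<rho> \<theta>) = curve (\<theta> + d)"
    and "right_tangent_line curve (rcis \<rho> \<theta>) = tangent_line curve (\<theta> + d)"
  unfolding right_tangency_point_def right_tangent_line_def
  using curve_cong tangent_line_cong cis_right_tangency_param[OF assms] by blast+

lemma reflected_line_eq:
  assumes "tangency_angle \<rho> \<theta> d"
  shows "reflected_line curve (rcis \<rho> \<theta>) = range (\<lambda>k. rcis k (\<theta> + 2 * d))"
proof -
  have refl: "reflect_across (curve (\<theta> + d)) (rcis k \<theta>) = rcis k (\<theta> + 2 * d)" for k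
    using p_pos[of "\<theta> + d"] unfolding polar_curve_def
    by (subst reflect_across_rcis) (auto intro!: arg_cong[of _ _ "rcis k"])
  have "\<rho> > 0" using assms by (simp add: tangency_angle_def)
  have "span {rcis \<rho> \<theta>} = range (\<lambda>k. rcis k \<theta>)"
  proof -
    have "rcis k \<theta> = (k / \<rho>) *\<^sub>R rcis \<rho> \<theta>" "k *\<^sub>R rcis \<rho> \<theta> = rcis (k * \<rho>) \<theta>" for k
      using \<open>\<rho> > 0\<close> by (simp_all add: complex_eq_iff)
    then show ?thesis
      unfolding span_singleton by blast
  qed
  then show ?thesis
    unfolding reflected_line_def right_tangency(1)[OF assms] by (simp add: image_image refl)
qed

text \<open>On the tangent at \<open>\<theta> + d\<close> the reflected point has the angular offset \<open>- d\<close>. The radius may be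
negative: the reflected line then meets the tangent on the opposite ray.\<close>

lemma angular_billiard_rcis:
  assumes "tangency_angle \<rho> \<theta> d" "inv_dist (\<theta> + d) (- d) \<noteq> 0"
  shows "angular_billiard curve (rcis \<rho> \<theta>) = rcis (1 / inv_dist (\<theta> + d) (- d)) (\<theta> + 2 * d)"
proof -
  have "rcis k (\<theta> + 2 * d) \<in> tangent_line curve (\<theta> + d) \<longleftrightarrow> k = 1 / inv_dist (\<theta> + d) (- d)" for k
    using assms(2) by (simp add: rcis_mem_tangent_line_iff field_simps)
  then show ?thesis
    unfolding angular_billiard_def reflected_line_eq[OF assms(1)] right_tangency(2)[OF assms(1)]
    by (intro the_equality) auto
qed

text \<open>The reflected line passes through the origin and the tangent does not, so they are parallel exactly
when they do not meet.\<close>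

lemma singular_set_iff:
  assumes "tangency_angle \<rho> \<theta> d" "rcis \<rho> \<theta> \<in> outer_region curve"
  shows "rcis \<rho> \<theta> \<in> singular_set curve \<longleftrightarrow> inv_dist (\<theta> + d) (- d) = 0"
proof -
  define m where "m = \<theta> + d"
  define L where "L = range (\<lambda>k. rcis k (m + d))"
  have L: "reflected_line curve (rcis \<rho> \<theta>) = L"
    unfolding reflected_line_eq[OF assms(1)] L_def m_def by (simp add: add.assoc)
  have "affine_parallel L (tangent_line curve m) \<longleftrightarrow> inv_dist m (- d) = 0"
  proof
    assume "affine_parallel L (tangent_line curve m)"
    then obtain a where a: "tangent_line curve m = (\<lambda>x. a + x) ` L"
      by (auto simp: affine_parallel_def)
    \<comment> \<open>If the lines met, the tangent would be a translate of the reflected line by one of its own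
        vectors, hence equal to it, and would pass through the origin.\<close>
    show "inv_dist m (- d) = 0"
    proof (rule ccontr)
      assume e: "inv_dist m (- d) \<noteq> 0"
      then have "rcis (1 / inv_dist m (- d)) (m + d) \<in> tangent_line curve m"
        by (simp add: rcis_mem_tangent_line_iff)
      then obtain k where "rcis (1 / inv_dist m (- d)) (m + d) = a + rcis k (m + d)"
        unfolding a L_def by blast
      then have "a + rcis (k - 1 / inv_dist m (- d)) (m + d) = 0"
        by (simp add: rcis_def algebra_simps)
      then have "rcis 0 m \<in> tangent_line curve m"
        unfolding a L_def by (metis image_eqI rangeI rcis_zero_mod)
      then show False
        unfolding rcis_mem_tangent_line_iff by simp
    qed
  next
    assume e: "inv_dist m (- d) = 0"
    \<comment> \<open>Here the tangent has the direction \<open>cis (m + d)\<close> of the reflected line, and \<open>q\<close> is the signed speed.\<close>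
    define q where "q = (p m * sin d - p' m * cos d) / p m ^ 2"
    have pm: "p m > 0" by (rule p_pos)
    have e': "p m * cos d = - p' m * sin d"
      using e by (simp add: inv_dist_def)
    have sc: "sin d * (sin d * x) + cos d * (cos d * x) = x" for x
      using sin_cos_squared_add[of d] by (metis distrib_right mult.assoc mult_1 power2_eq_square)
    have h: "cos d * (sin d * p m) = - (sin d * (sin d * p' m))"
      "cos d * (sin d * p' m) = - (cos d * (cos d * p m))"
      using arg_cong[OF e', of "\<lambda>x. x * sin d"] arg_cong[OF e', of "\<lambda>x. x * cos d"]
      by (simp_all add: algebra_simps)
    have v1: "Complex (- p' m) (p m) / p m ^ 2 = q *\<^sub>R cis d"
    proof -
      have "- p' m = (p m * sin d - p' m * cos d) * cos d"
        using sc[of "p' m"] h by (simp add: algebra_simps)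
      moreover have "p m = (p m * sin d - p' m * cos d) * sin d"
        using sc[of "p m"] h by (simp add: algebra_simps)
      ultimately show ?thesis
        using pm by (simp add: complex_eq_iff q_def)
    qed
    have v: "vel curve m = q *\<^sub>R cis (m + d)"
      unfolding vel_curve v1 by (simp add: cis_mult add.commute)
    have "q \<noteq> 0" using v1 pm by (auto simp: complex_eq_iff)
    have "tangent_line curve m = (\<lambda>x. curve m + x) ` L"
    proof -
      have 1: "rcis k (m + d) = (k / q) *\<^sub>R vel curve m" for k
        unfolding v using \<open>q \<noteq> 0\<close> by (simp add: complex_eq_iff)
      have 2: "s *\<^sub>R vel curve m = rcis (s * q) (m + d)" for s
        unfolding v by (simp add: complex_eq_iff)
      have "tangent_line curve m \<subseteq> (\<lambda>x. curve m + x) ` L"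
        unfolding tangent_line_def L_def 2 by blast
      moreover have "(\<lambda>x. curve m + x) ` L \<subseteq> tangent_line curve m"
        unfolding tangent_line_def L_def 1 by blast
      ultimately show ?thesis by (rule equalityI)
    qed
    then show "affine_parallel L (tangent_line curve m)"
      unfolding affine_parallel_def by blast
  qed
  then show ?thesis
    using assms(2) by (simp add: singular_set_def L right_tangency(2)[OF assms(1)] m_def)
qed

text \<open>Let \<open>u\<close> and \<open>v\<close> be the inverse radii of the point and of its image, at the angles \<open>m - d\<close> and \<open>m + d\<close>
symmetric about the angle \<open>m\<close> of the tangency point. The tangency point is their combination with
the weights \<open>u / (u + v)\<close> and \<open>v / (u + v)\<close>; as \<open>u > 0\<close>, both are nonnegative only if \<open>v > 0\<close>.\<close>

lemma segment_domain_iff: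
  assumes "tangency_angle \<rho> \<theta> d" "rcis \<rho> \<theta> \<in> outer_region curve"
  shows "rcis \<rho> \<theta> \<in> segment_domain curve \<longleftrightarrow> inv_dist (\<theta> + d) (- d) > 0"
proof (cases "inv_dist (\<theta> + d) (- d) = 0")
  case True
  then show ?thesis
    using singular_set_iff[OF assms] by (simp add: segment_domain_def)
next
  case False
  define m u v where "m = \<theta> + d" and "u = inv_dist m d" and "v = inv_dist m (- d)"
  have \<rho>: "\<rho> > 0" and d: "0 \<le> d" "d < pi" and "\<rho> * u = 1"
    using assms(1) by (auto simp: tangency_angle_def u_def m_def)
  then have u: "\<rho> = 1 / u"
    by (metis eq_divide_eq mult_zero_right zero_neq_one)
  with \<rho> have "u > 0" by simp
  have "v \<noteq> 0" using False by (simp add: v_def m_def)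
  have \<theta>: "\<theta> = m - d" "\<theta> + 2 * d = m + d" by (simp_all add: m_def)
  have "rcis \<rho> \<theta> \<in> segment_domain curve \<longleftrightarrow>
      curve m \<in> closed_segment (rcis (1 / u) (m - d)) (rcis (1 / v) (m + d))"
    using assms singular_set_iff[OF assms] False right_tangency(1)[OF assms(1)]
      angular_billiard_rcis[OF assms(1) False]
    unfolding segment_domain_def u v_def \<theta> by (simp add: add.commute)
  also have "\<dots> \<longleftrightarrow> v > 0"
  proof
    assume "v > 0"
    define l where "l = v / (u + v)"
    have uv: "u + v = 2 * p m * cos d"
      unfolding u_def v_def by (rule inv_dist_add)
    have l: "0 \<le> l" "l \<le> 1" "(1 - l) / u = 1 / (u + v)" "l / v = 1 / (u + v)"
    proof -
      have "1 - l = u / (u + v)"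
        using \<open>u > 0\<close> \<open>v > 0\<close> by (simp add: l_def diff_divide_eq_iff)
      then show "(1 - l) / u = 1 / (u + v)" "l / v = 1 / (u + v)" "0 \<le> l" "l \<le> 1"
        using \<open>u > 0\<close> \<open>v > 0\<close> by (simp_all add: l_def)
    qed
    have "cos d \<noteq> 0"
      using uv \<open>u > 0\<close> \<open>v > 0\<close> by auto
    have "(1 - l) *\<^sub>R rcis (1 / u) (m - d) + l *\<^sub>R rcis (1 / v) (m + d)
        = rcis ((1 - l) / u) (m - d) + rcis (l / v) (m + d)"
      by (simp add: complex_eq_iff)
    also have "\<dots> = rcis (2 * cos d / (u + v)) m"
      unfolding l by (simp add: complex_eq_iff cos_add cos_diff sin_add sin_diff add_divide_distrib[symmetric])
    also have "\<dots> = curve m"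
      using \<open>cos d \<noteq> 0\<close> p_pos[of m] unfolding uv polar_curve_def by simp
    finally show "curve m \<in> closed_segment (rcis (1 / u) (m - d)) (rcis (1 / v) (m + d))"
      using l unfolding in_segment by metis
  next
    assume "curve m \<in> closed_segment (rcis (1 / u) (m - d)) (rcis (1 / v) (m + d))"
    then obtain l where l: "0 \<le> l" "l \<le> 1"
      and eq: "curve m = (1 - l) *\<^sub>R rcis (1 / u) (m - d) + l *\<^sub>R rcis (1 / v) (m + d)"
      unfolding in_segment by blast
    show "v > 0"
    proof (cases "d = 0")
      case True
      then show ?thesis using p_pos by (simp add: v_def)
    next
      case False
      then have "sin d > 0" using d by (intro sin_gt_zero) auto
      \<comment> \<open>Rotated by \<open>- m\<close>, the tangency point is real; the imaginary part of the convex combination vanishes.\<close>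
      have "rcis (1 / p m) 0 = curve m * cis (- m)"
        by (simp add: polar_curve_def rcis_def cis_mult)
      also have "\<dots> = (1 - l) *\<^sub>R rcis (1 / u) (- d) + l *\<^sub>R rcis (1 / v) d"
        unfolding eq by (simp add: rcis_def distrib_right mult.assoc cis_mult)
      finally have "Im (rcis (1 / p m) 0)
          = Im ((1 - l) *\<^sub>R rcis (1 / u) (- d) + l *\<^sub>R rcis (1 / v) d)"
        by (rule arg_cong)
      moreover have "Im ((1 - l) *\<^sub>R rcis (1 / u) (- d) + l *\<^sub>R rcis (1 / v) d)
          = (l / v - (1 - l) / u) * sin d"
        by (simp add: left_diff_distrib)
      ultimately have "(l / v - (1 - l) / u) * sin d = 0"
        by (simp only: Im_rcis sin_zero mult_zero_right)
      then have lv: "l / v = (1 - l) / u"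
        using \<open>sin d > 0\<close> by (simp only: mult_eq_0_iff right_minus_eq) simp
      show "v > 0"
      proof (rule ccontr)
        assume "\<not> v > 0"
        then have "l / v \<le> 0" using l by (simp add: divide_nonneg_nonpos)
        moreover have "(1 - l) / u \<ge> 0" using l \<open>u > 0\<close> by simp
        ultimately have "l / v = 0" "(1 - l) / u = 0" using lv by linarith+
        then show False using \<open>u > 0\<close> \<open>v \<noteq> 0\<close> by simp
      qed
    qed
  qed
  finally show ?thesis by (simp add: v_def m_def)
qed

text \<open>As \<open>inv_dist m d + inv_dist m (- d) = 2 * p m * cos d\<close>, positive inverse radii at both ends leave less
than a right angle between the point and the tangency point.\<close>

lemma segment_domain_tangency:
  assumes "0 \<in> inside (range curve)" "M \<in> segment_domain curve" "M = rcis (norm M) \<theta>"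
  obtains d where "tangency_angle (norm M) \<theta> d" "inv_dist (\<theta> + d) (- d) > 0" "d < pi / 2"
proof -
  have out: "M \<in> outer_region curve"
    using assms(2) by (simp add: segment_domain_def)
  obtain d where d: "tangency_angle (norm M) \<theta> d"
    by (rule outer_point_tangency[OF assms(1) out assms(3)])
  have v: "inv_dist (\<theta> + d) (- d) > 0"
    using segment_domain_iff[OF d] out assms(2,3) by simp
  have "inv_dist (\<theta> + d) d > 0"
    using tangency_angle_inv_dist[OF d] by simp
  with v have "0 < 2 * p (\<theta> + d) * cos d"
    unfolding inv_dist_add[symmetric] by (rule add_pos_pos[rotated])
  then have "cos d > 0"
    using p_pos[of "\<theta> + d"] by (simp add: zero_less_mult_iff)
  then have "d < pi / 2"
    using d cos_monotone_0_pi_le[of "pi / 2" d] by (force simp: tangency_angle_def)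
  with d v show thesis by (rule that)
qed

section \<open>Invariance of the symplectic form\<close>

text \<open>The complex number \<open>t + \<i> * d\<close> stands for the pair \<open>(t, d)\<close>, so that conjugation is the sign change
of \<open>d\<close> and source and target of the chart have the same type, as the inverse function theorem
requires.\<close>

definition tangent_chart :: "complex \<Rightarrow> complex" where
  "tangent_chart w = rcis (1 / inv_dist (Re w) (Im w)) (Re w - Im w)"

text \<open>The multiplier of \<open>tangent_chart w\<close> is the logarithmic derivative of the point: the real part comes
from the differential of \<open>inv_dist\<close>, the imaginary part from that of the angle \<open>t - d\<close>.\<close>

definition chart_deriv :: "complex \<Rightarrow> complex \<Rightarrow> complex" where
  "chart_deriv w k = tangent_chart w *
     Complex (- (Re k * (p' (Re w) * cos (Im w) - p'' (Re w) * sin (Im w))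
       - Im k * (p (Re w) * sin (Im w) + p' (Re w) * cos (Im w))) / inv_dist (Re w) (Im w))
     (Re k - Im k)"

lemma has_derivative_tangent_chart:
  assumes "inv_dist (Re w) (Im w) \<noteq> 0"
  shows "(tangent_chart has_derivative chart_deriv w) (at w)"
  unfolding tangent_chart_def[abs_def] chart_deriv_def[abs_def]
  by (intro has_derivative_polar has_derivative_inv_dist assms)
    (auto intro!: derivative_eq_intros)

text \<open>The pullback of the form by the chart. The expression is unchanged when \<open>w\<close>, \<open>k\<close> and \<open>l\<close> are all
conjugated, since \<open>sin (Im w)\<close> and \<open>Im (cnj k * l)\<close> both change sign.\<close>

lemma symplectic_form_chart_deriv:
  assumes "inv_dist (Re w) (Im w) > 0"
  shows "symplectic_form (tangent_chart w) (chart_deriv w k) (chart_deriv w l) =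
    (p (Re w) + p'' (Re w)) * sin (Im w) * Im (cnj k * l)"
  unfolding chart_deriv_def unfolding tangent_chart_def symplectic_form_polar[OF assms]
  by (simp add: algebra_simps)

text \<open>The pullback of the form is nondegenerate, hence so is the derivative.\<close>

lemma surj_chart_deriv:
  assumes "inv_dist (Re w) (Im w) > 0" "sin (Im w) \<noteq> 0"
  shows "surj (chart_deriv w)"
proof (rule linear_injective_imp_surjective)
  show lin: "linear (chart_deriv w)"
    using has_derivative_tangent_chart assms(1) has_derivative_linear less_irrefl by metis
  have "k = 0" if "chart_deriv w k = 0" for k
  proof -
    have "tangent_chart w \<noteq> 0" using assms(1) by (simp add: tangent_chart_def)
    then have "symplectic_form (tangent_chart w) (chart_deriv w k) (chart_deriv w (\<i> * k)) = 0"
      using that by (simp add: symplectic_form_eq)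
    then have "Im (cnj k * (\<i> * k)) = 0"
      using symplectic_form_chart_deriv[OF assms(1)] assms(2) curv_pos[of "Re w"] by auto
    then show "k = 0"
      by (simp add: complex_eq_iff sum_squares_eq_zero_iff)
  qed
  then show "inj (chart_deriv w)"
    by (simp add: linear_injective_0[OF lin])
qed (rule refl)

text \<open>The width \<open>2 * pi\<close> in the direction of \<open>t\<close> makes the chart injective.\<close>

definition chart_domain :: "real \<Rightarrow> complex set" where
  "chart_domain t = {w. \<bar>Re w - t\<bar> < pi \<and> 0 < Im w \<and> Im w < pi \<and>
     0 < inv_dist (Re w) (Im w) \<and> 0 < inv_dist (Re w) (- Im w)}"

lemma open_chart_domain: "open (chart_domain t)"
  unfolding chart_domain_def
  by (intro open_Collect_conj open_Collect_less continuous_on_inv_dist continuous_intros)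

lemma tangency_angle_chart:
  assumes "w \<in> chart_domain t"
  shows "tangency_angle (1 / inv_dist (Re w) (Im w)) (Re w - Im w) (Im w)"
  using assms by (simp add: tangency_angle_def chart_domain_def)

lemma angular_billiard_chart:
  assumes "w \<in> chart_domain t"
  shows "angular_billiard curve (tangent_chart w) = tangent_chart (cnj w)"
  using angular_billiard_rcis[OF tangency_angle_chart[OF assms]] assms
  by (simp add: tangent_chart_def chart_domain_def add.commute)

lemma inj_on_tangent_chart: "inj_on tangent_chart (chart_domain t)"
proof (rule inj_onI)
  fix w w' assume w: "w \<in> chart_domain t" "w' \<in> chart_domain t"
    and eq: "tangent_chart w = tangent_chart w'"
  then have dist: "1 / inv_dist (Re w) (Im w) = 1 / inv_dist (Re w') (Im w')"
    and ang: "cis (Re w - Im w) = cis (Re w' - Im w')"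
    unfolding tangent_chart_def by (subst (asm) rcis_pos_eq_iff, auto simp: chart_domain_def)+
  have im: "Im w = Im w'"
    using tangency_angle_unique[OF _ _ ang] tangency_angle_chart w dist by metis
  have "cis (Re w - Im w + Im w) = cis (Re w' - Im w' + Im w)"
    using ang by (simp only: cis_mult[symmetric])
  then have "cis (Re w) = cis (Re w')" by (simp add: im)
  moreover have "\<bar>Re w - t\<bar> < pi" "\<bar>Re w' - t\<bar> < pi"
    using w unfolding chart_domain_def by blast+
  then have "\<bar>Re w - Re w'\<bar> < 2 * pi" by linarith
  ultimately have "Re w = Re w'" by (rule cis_inj_period)
  then show "w = w'" using im by (rule complex_eqI)
qed

text \<open>The billiard map is the chart, after conjugation, after the inverse of the chart; the derivative of
the inverse comes from the inverse function theorem, and invariance of domain provides a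
neighbourhood on which this description is valid.\<close>

lemma preserves_symplectic_form_chart:
  assumes w: "w \<in> chart_domain t"
  shows "preserves_symplectic_form_at (angular_billiard curve) (tangent_chart w)"
proof -
  define S where "S = chart_domain t"
  define g where "g = inv_into S tangent_chart"
  define g' where "g' = inv (chart_deriv w)"
  have pos: "inv_dist (Re w) (Im w) > 0" "inv_dist (Re (cnj w)) (Im (cnj w)) > 0" "sin (Im w) > 0"
    using w by (auto simp: chart_domain_def intro: sin_gt_zero)
  have cont: "continuous_on S tangent_chart"
    by (rule has_derivative_continuous_on, rule has_derivative_at_withinI,
        rule has_derivative_tangent_chart) (auto simp: S_def chart_domain_def)
  have inj: "inj_on tangent_chart S"
    unfolding S_def by (rule inj_on_tangent_chart)
  have D_g': "chart_deriv w (g' u) = u" for u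
    unfolding g'_def using surj_chart_deriv[OF pos(1)] pos(3) by (simp add: surj_f_inv_f)
  have g: "(g has_derivative g') (at (tangent_chart w))"
  proof (rule has_derivative_inverse_strong[of S w tangent_chart])
    show "g (tangent_chart x) = x" if "x \<in> S" for x
      using inj that by (simp add: g_def)
    show "chart_deriv w \<circ> g' = id"
      using D_g' by auto
  qed (use w cont pos in \<open>auto simp: S_def open_chart_domain intro: has_derivative_tangent_chart\<close>)
  have gw: "g (tangent_chart w) = w"
    using inj w by (simp add: g_def S_def)
  define L where "L = (\<lambda>u. chart_deriv (cnj w) (cnj (g' u)))"
  have "((\<lambda>z. tangent_chart (cnj (g z))) has_derivative L) (at (tangent_chart w))"
    unfolding L_def
  proof (rule has_derivative_compose[where f = "\<lambda>z. cnj (g z)" and f' = "\<lambda>u. cnj (g' u)"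
        and g = tangent_chart and g' = "chart_deriv (cnj w)"])
    show "((\<lambda>z. cnj (g z)) has_derivative (\<lambda>u. cnj (g' u))) (at (tangent_chart w))"
      by (rule bounded_linear.has_derivative[OF bounded_linear_cnj g])
    show "(tangent_chart has_derivative chart_deriv (cnj w)) (at (cnj (g (tangent_chart w))))"
      unfolding gw using pos(2) by (intro has_derivative_tangent_chart) auto
  qed
  then have "(angular_billiard curve has_derivative L) (at (tangent_chart w))"
  proof (rule has_derivative_transform_within_open)
    show "open (tangent_chart ` S)"
      by (rule invariance_of_domain[OF cont _ inj]) (simp add: S_def open_chart_domain)
    show "tangent_chart w \<in> tangent_chart ` S"
      using w by (simp add: S_def)
    show "tangent_chart (cnj (g z)) = angular_billiard curve z" if "z \<in> tangent_chart ` S" for z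
      using that inj angular_billiard_chart by (auto simp: g_def S_def)
  qed
  moreover have "symplectic_form (angular_billiard curve (tangent_chart w)) (L u) (L v)
      = symplectic_form (tangent_chart w) u v" for u v
  proof -
    have "symplectic_form (angular_billiard curve (tangent_chart w)) (L u) (L v) =
        (p (Re w) + p'' (Re w)) * sin (Im w) * Im (cnj (g' u) * g' v)"
      unfolding angular_billiard_chart[OF w] L_def symplectic_form_chart_deriv[OF pos(2)]
      by (simp add: algebra_simps)
    also have "\<dots> = symplectic_form (tangent_chart w) (chart_deriv w (g' u)) (chart_deriv w (g' v))"
      unfolding symplectic_form_chart_deriv[OF pos(1)] ..
    finally show ?thesis unfolding D_g' .
  qed
  ultimately show ?thesis
    unfolding preserves_symplectic_form_at_def by blast
qed

lemma preserves_symplectic_form: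
  assumes "0 \<in> inside (range curve)" "M \<in> segment_domain curve" "M \<notin> range curve"
  shows "preserves_symplectic_form_at (angular_billiard curve) M"
proof -
  define \<theta> where "\<theta> = Arg M"
  have M: "M = rcis (norm M) \<theta>"
    by (simp add: \<theta>_def rcis_cmod_Arg)
  obtain d where d: "tangency_angle (norm M) \<theta> d" "inv_dist (\<theta> + d) (- d) > 0"
    by (rule segment_domain_tangency[OF assms(1,2) M])
  have "d \<noteq> 0"
    using tangency_angle_0_iff[OF d(1)] assms(3) M by simp
  have u: "inv_dist (\<theta> + d) d > 0" "1 / inv_dist (\<theta> + d) d = norm M"
    using tangency_angle_inv_dist[OF d(1)] by simp_all
  define w where "w = Complex (\<theta> + d) d"
  have "w \<in> chart_domain (\<theta> + d)"
    using d \<open>d \<noteq> 0\<close> u by (auto simp: w_def chart_domain_def tangency_angle_def)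
  moreover have "tangent_chart w = M"
    using M u by (simp add: tangent_chart_def w_def)
  ultimately show ?thesis
    using preserves_symplectic_form_chart by metis
qed

section \<open>The generating function\<close>

lemma generating_function_eq:
  "generating_function (\<lambda>t. 1 / p t) a b = 2 * p ((a + b) / 2) * sin ((b - a) / 2)"
  by (simp add: generating_function_def)

lemma generating_function_deriv_fst:
  "((\<lambda>x. - generating_function (\<lambda>t. 1 / p t) x b) has_real_derivative
     inv_dist ((a + b) / 2) ((b - a) / 2)) (at a)"
proof -
  have "((\<lambda>x. p ((x + b) / 2)) has_real_derivative p' ((a + b) / 2) * (1 / 2)) (at a)"
    by (rule DERIV_chain2[OF deriv_p]) (auto intro!: derivative_eq_intros)
  then show ?thesis
    unfolding generating_function_eq inv_dist_def
    by (auto intro!: derivative_eq_intros simp: algebra_simps)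
qed

lemma generating_function_deriv_snd:
  "((\<lambda>y. generating_function (\<lambda>t. 1 / p t) a y) has_real_derivative
     inv_dist ((a + b) / 2) (- ((b - a) / 2))) (at b)"
proof -
  have "((\<lambda>y. p ((a + y) / 2)) has_real_derivative p' ((a + b) / 2) * (1 / 2)) (at b)"
    by (rule DERIV_chain2[OF deriv_p]) (auto intro!: derivative_eq_intros)
  then show ?thesis
    unfolding generating_function_eq inv_dist_def
    by (auto intro!: derivative_eq_intros simp: algebra_simps)
qed

text \<open>In \<open>inv_dist ((x + b) / 2) ((x - b) / 2)\<close>, the derivative of the generating function in the second
argument, both arguments move with \<open>x\<close> at the rate \<open>1 / 2\<close>, as on the ray of fixed angle \<open>b\<close>; so the
mixed derivative has the sign of \<open>p + p''\<close>.\<close>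

lemma twist_condition:
  assumes "0 < b - a" "b - a < 2 * pi"
  shows "twist_condition_at (generating_function (\<lambda>t. 1 / p t)) a b"
proof -
  define D where "D = (p ((a + b) / 2) + p'' ((a + b) / 2)) * sin ((b - a) / 2) / 2"
  have "((\<lambda>x. inv_dist ((x + b) / 2) (- ((b - x) / 2))) has_real_derivative D) (at a)"
    unfolding has_field_derivative_def
    by (rule has_derivative_eq_rhs[OF has_derivative_inv_dist[where a' = "\<lambda>h. h / 2" and b' = "\<lambda>h. h / 2"]])
      (auto intro!: derivative_eq_intros simp: D_def algebra_simps fun_eq_iff)
  moreover have "D > 0"
    unfolding D_def using assms curv_pos[of "(a + b) / 2"] by (auto intro!: mult_pos_pos sin_gt_zero)
  moreover have "\<forall>\<^sub>F x in nhds a. (generating_function (\<lambda>t. 1 / p t) x has_real_derivative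
      inv_dist ((x + b) / 2) (- ((b - x) / 2))) (at b)"
    by (intro always_eventually allI generating_function_deriv_snd)
  ultimately show ?thesis
    unfolding twist_condition_at_def
    by (intro exI[of _ "\<lambda>x. inv_dist ((x + b) / 2) (- ((b - x) / 2))"] exI[of _ D]) blast
qed

lemma lifted_angles_exist:
  assumes "0 \<in> inside (range curve)" "M \<in> segment_domain curve" "M = rcis (norm M) \<phi>\<^sub>1"
  shows "\<exists>\<phi>\<^sub>2. lifted_angles curve M \<phi>\<^sub>1 \<phi>\<^sub>2"
proof -
  obtain d where d: "tangency_angle (norm M) \<phi>\<^sub>1 d" "inv_dist (\<phi>\<^sub>1 + d) (- d) > 0" "d < pi / 2"
    by (rule segment_domain_tangency[OF assms])
  have "angular_billiard curve M = rcis (1 / inv_dist (\<phi>\<^sub>1 + d) (- d)) (\<phi>\<^sub>1 + 2 * d)"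
    using angular_billiard_rcis[OF d(1)] d(2) assms(3) by simp
  moreover have "M \<in> range curve \<longleftrightarrow> d = 0"
    using tangency_angle_0_iff[OF d(1)] assms(3) by simp
  ultimately have "lifted_angles curve M \<phi>\<^sub>1 (\<phi>\<^sub>1 + 2 * d)"
    using d assms(3) by (auto simp: lifted_angles_def tangency_angle_def)
  then show ?thesis by blast
qed

text \<open>The lifts are determined up to the period by the points themselves; the bounds on their difference
leave only \<open>\<phi>\<^sub>2 = \<phi>\<^sub>1 + 2 * d\<close>.\<close>

lemma lifted_angles_tangency:
  assumes "0 \<in> inside (range curve)" "M \<in> segment_domain curve" "lifted_angles curve M \<phi>\<^sub>1 \<phi>\<^sub>2"
  defines "m \<equiv> (\<phi>\<^sub>1 + \<phi>\<^sub>2) / 2" and "\<delta> \<equiv> (\<phi>\<^sub>2 - \<phi>\<^sub>1) / 2"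
  shows "right_tangency_point curve M = curve m"
    and "inv_dist m \<delta> = 1 / norm M"
    and "inv_dist m (- \<delta>) = 1 / norm (angular_billiard curve M)"
proof -
  have M: "M = rcis (norm M) \<phi>\<^sub>1"
    using assms(3) by (simp add: lifted_angles_def)
  obtain d where d: "tangency_angle (norm M) \<phi>\<^sub>1 d" and v: "inv_dist (\<phi>\<^sub>1 + d) (- d) > 0" and "d < pi / 2"
    by (rule segment_domain_tangency[OF assms(1,2) M])
  have B: "angular_billiard curve M = rcis (1 / inv_dist (\<phi>\<^sub>1 + d) (- d)) (\<phi>\<^sub>1 + 2 * d)"
    using angular_billiard_rcis[OF d(1)] v M by simp
  then have normB: "norm (angular_billiard curve M) = 1 / inv_dist (\<phi>\<^sub>1 + d) (- d)"
    using v by simp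
  have "cis \<phi>\<^sub>2 = cis (\<phi>\<^sub>1 + 2 * d)"
  proof -
    have "rcis (1 / inv_dist (\<phi>\<^sub>1 + d) (- d)) \<phi>\<^sub>2 = rcis (1 / inv_dist (\<phi>\<^sub>1 + d) (- d)) (\<phi>\<^sub>1 + 2 * d)"
      using assms(3) B normB by (simp add: lifted_angles_def)
    then show ?thesis
      using v by (subst (asm) rcis_pos_eq_iff) auto
  qed
  moreover have "\<bar>\<phi>\<^sub>2 - (\<phi>\<^sub>1 + 2 * d)\<bar> < 2 * pi"
    using assms(3) d \<open>d < pi / 2\<close> pi_gt_zero
    by (auto simp: lifted_angles_def tangency_angle_def abs_less_iff split: if_splits)
  ultimately have "\<phi>\<^sub>2 = \<phi>\<^sub>1 + 2 * d"
    by (rule cis_inj_period)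
  then have md: "m = \<phi>\<^sub>1 + d" "\<delta> = d"
    by (simp_all add: m_def \<delta>_def)
  show "right_tangency_point curve M = curve m"
    using right_tangency(1)[OF d] M md by simp
  show "inv_dist m (- \<delta>) = 1 / norm (angular_billiard curve M)"
    unfolding normB md by simp
  have "norm M > 0" "norm M * inv_dist m \<delta> = 1"
    using d by (simp_all add: tangency_angle_def md)
  then show "inv_dist m \<delta> = 1 / norm M"
    by (simp add: eq_divide_eq mult.commute)
qed

section \<open>The segment domain near the curve\<close>

text \<open>By periodicity and compactness \<open>- p' \<le> K * p\<close> for a constant \<open>K\<close>, and then \<open>inv_dist t (- d)\<close> is at
least \<open>p t * (cos d - K * sin d)\<close>, which is positive for small \<open>d\<close>.\<close>

lemma image_side_uniform:
  obtains \<epsilon> where "0 < \<epsilon>" "\<epsilon> < pi / 2" "\<And>t d. 0 \<le> d \<Longrightarrow> d \<le> \<epsilon> \<Longrightarrow> inv_dist t (- d) > 0"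
proof -
  have "continuous_on {0..2 * pi} (\<lambda>t. p' t / p t)"
  proof (intro continuous_on_divide ballI continuous_at_imp_continuous_on)
    show "isCont p' t" "isCont p t" "p t \<noteq> 0" for t
      using isCont_p' isCont_p p_pos[of t] by simp_all
  qed
  then have "bounded ((\<lambda>t. p' t / p t) ` {0..2 * pi})"
    by (rule compact_imp_bounded[OF compact_continuous_image[OF _ compact_Icc]])
  then obtain K where "K > 0" and K_image: "\<forall>x\<in>(\<lambda>t. p' t / p t) ` {0..2 * pi}. norm x \<le> K"
    unfolding bounded_pos by blast
  have K: "\<bar>p' t / p t\<bar> \<le> K" if "0 \<le> t" "t \<le> 2 * pi" for t
    using K_image that by simp
  have bound: "- p' t \<le> K * p t" for t
  proof -
    obtain s where s: "0 \<le> s" "s < 2 * pi" "cis s = cis t"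
      by (rule obtain_cis_period[of t])
    have "- p' s \<le> K * p s"
      using K[of s] s p_pos[of s] by (simp add: abs_if divide_simps split: if_splits)
    then show ?thesis
      using p_cong[OF s(3)] periodic_cis_cong[of p', OF p'_periodic s(3)] by simp
  qed
  \<comment> \<open>An acute angle with \<open>K * tan \<epsilon> < 1\<close>.\<close>
  define \<epsilon> where "\<epsilon> = arctan (1 / (K + 1))"
  have \<epsilon>: "0 < \<epsilon>" "\<epsilon> < pi / 2"
    using \<open>K > 0\<close> arctan_ubound by (auto simp: \<epsilon>_def)
  have "inv_dist t (- d) > 0" if d: "0 \<le> d" "d \<le> \<epsilon>" for t d
  proof -
    have "cos d > 0" "sin d \<ge> 0"
      using d \<epsilon> by (auto intro!: cos_gt_zero_pi sin_ge_zero)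
    have "tan d \<le> tan \<epsilon>"
      using d \<epsilon> by (intro tan_mono_le) auto
    then have "tan d \<le> 1 / (K + 1)"
      by (simp add: \<epsilon>_def tan_arctan)
    then have "(K + 1) * sin d \<le> cos d"
      using \<open>cos d > 0\<close> \<open>K > 0\<close> by (simp add: tan_def field_simps)
    moreover have "sin d > 0 \<or> sin d = 0" using \<open>sin d \<ge> 0\<close> by auto
    ultimately have "K * sin d < cos d"
      using \<open>cos d > 0\<close> by (auto simp: algebra_simps)
    then have "0 < p t * (cos d - K * sin d)"
      using p_pos[of t] by simp
    also have "\<dots> \<le> p t * cos d + p' t * sin d"
      using mult_right_mono[OF bound[of t] \<open>sin d \<ge> 0\<close>] by (simp add: algebra_simps)
    finally show ?thesis by (simp add: inv_dist_def)
  qed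
  with \<epsilon> show thesis by (rule that)
qed

text \<open>With \<open>\<epsilon>\<close> from the preceding lemma, let \<open>W\<close> consist of the points other than the origin that lie, on
their ray \<open>\<theta>\<close>, strictly before the tangent at \<open>\<theta> + \<epsilon>\<close>. It contains the curve, and by monotonicity
the right tangency point of an outer point of \<open>W\<close> is at an angle of at most \<open>\<epsilon>\<close> from the ray.\<close>

lemma segment_domain_near_curve:
  assumes "0 \<in> inside (range curve)"
  obtains W where "open W" "range curve \<subseteq> W" "W \<inter> outer_region curve \<subseteq> segment_domain curve"
proof -
  obtain \<epsilon> where \<epsilon>: "0 < \<epsilon>" "\<epsilon> < pi / 2" and pos: "\<And>t d. 0 \<le> d \<Longrightarrow> d \<le> \<epsilon> \<Longrightarrow> inv_dist t (- d) > 0"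
    by (rule image_side_uniform) blast
  define f where "f = (\<lambda>\<theta>. inv_dist (\<theta> + \<epsilon>) \<epsilon>)"
  have f_per: "f (\<theta> + 2 * pi) = f \<theta>" for \<theta>
    unfolding f_def by (rule inv_dist_cong) (simp_all flip: cis_mult)
  have f_cont: "isCont f \<theta>" for \<theta>
  proof -
    have "continuous_on UNIV f"
      unfolding f_def by (intro continuous_on_inv_dist continuous_intros)
    then show ?thesis by (simp add: continuous_on_eq_continuous_at)
  qed
  define W where "W = {z \<in> - {0}. norm z * f (Arg z) < 1}"
  have f_Arg: "f (Arg (rcis \<rho> \<theta>)) = f \<theta>" if "\<rho> > 0" for \<rho> \<theta>
  proof (rule periodic_cis_cong[of f, OF f_per])
    show "cis (Arg (rcis \<rho> \<theta>)) = cis \<theta>"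
      using that by (subst cis_Arg) (auto simp: rcis_def sgn_mult sgn_of_real)
  qed
  show thesis
  proof
    show "open W"
    proof -
      have "W = (- {0}) \<inter> (\<lambda>z. norm z * f (Arg z)) -` {..<1}"
        by (auto simp: W_def)
      also have "open \<dots>"
        by (rule continuous_open_preimage)
          (auto intro!: continuous_intros continuous_on_periodic_Arg f_cont f_per)
      finally show ?thesis .
    qed
    show "range curve \<subseteq> W"
    proof clarify
      fix t
      have "f t < p t"
        using inv_dist_strict_decreasing[of 0 \<epsilon> t] \<epsilon> by (simp add: f_def)
      then show "curve t \<in> W"
        using p_pos[of t] f_Arg[of "1 / p t" t] by (simp add: W_def polar_curve_def)
    qed
    show "W \<inter> outer_region curve \<subseteq> segment_domain curve"
    proof clarify
      fix M assume MW: "M \<in> W" and out: "M \<in> outer_region curve"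
      define \<theta> where "\<theta> = Arg M"
      have M: "M = rcis (norm M) \<theta>"
        by (simp add: \<theta>_def rcis_cmod_Arg)
      obtain d where d: "tangency_angle (norm M) \<theta> d"
        by (rule outer_point_tangency[OF assms out M])
      have "norm M * f \<theta> < norm M * inv_dist (\<theta> + d) d"
        using MW d by (simp add: W_def \<theta>_def tangency_angle_def)
      then have "inv_dist (\<theta> + \<epsilon>) \<epsilon> < inv_dist (\<theta> + d) d"
        using tangency_angle_inv_dist(2)[OF d] unfolding f_def by (simp only: mult_less_cancel_left_pos)
      moreover have "inv_dist (\<theta> + d) d \<le> inv_dist (\<theta> + \<epsilon>) \<epsilon>" if "d \<ge> \<epsilon>"
        using that inv_dist_strict_decreasing[of \<epsilon> d \<theta>] \<epsilon> d
        by (cases "d = \<epsilon>") (auto simp: tangency_angle_def)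
      ultimately have "d \<le> \<epsilon>" by linarith
      then have "inv_dist (\<theta> + d) (- d) > 0"
        using pos d by (auto simp: tangency_angle_def)
      then show "M \<in> segment_domain curve"
        using segment_domain_iff[OF d] out M by simp
    qed
  qed
qed

end

section \<open>The inverse radius of a smooth polar curve\<close>

lemma smooth_curve_derivs:
  assumes "smooth_curve G"
  shows "(G has_vector_derivative vel G t) (at t)"
    and "(vel G has_vector_derivative vel (vel G) t) (at t)"
proof -
  have "G differentiable at t" "vel G differentiable at t"
    using assms[unfolded smooth_curve_def, rule_format, of 0]
      assms[unfolded smooth_curve_def, rule_format, of 1]
    by (auto simp: differentiable_on_def)
  then show "(G has_vector_derivative vel G t) (at t)"
    "(vel G has_vector_derivative vel (vel G) t) (at t)"
    unfolding vel_def by (auto simp: vector_derivative_works[symmetric])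
qed

text \<open>The radius is \<open>Re (G t * cis (- t))\<close>, so it inherits the derivatives of the curve \<open>G\<close>. The curvature is
then the classical expression in polar coordinates.\<close>

lemma polar_curve_radius_derivs:
  assumes "smooth_curve (polar_curve r)"
  obtains r' r'' where "\<And>t. (r has_real_derivative r' t) (at t)"
    and "\<And>t. (r' has_real_derivative r'' t) (at t)"
    and "\<And>t. curvature (polar_curve r) t = (r t ^ 2 + 2 * r' t ^ 2 - r t * r'' t) / norm (vel (polar_curve r) t) ^ 3"
proof -
  define G where "G = polar_curve r"
  note G' = smooth_curve_derivs[OF assms, folded G_def]
  have cis': "((\<lambda>t. cis (- t)) has_vector_derivative - \<i> * cis (- t)) (at t)" for t
    unfolding has_vector_derivative_def
    by (rule has_derivative_eq_rhs[OF has_derivative_cis]) (auto intro!: derivative_eq_intros simp: scaleR_conv_of_real)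
  have rotate: "((\<lambda>t. f t * cis (- t)) has_vector_derivative (f' - \<i> * f t) * cis (- t)) (at t)"
    if "(f has_vector_derivative f') (at t)" for f :: "real \<Rightarrow> complex" and f' t
    using has_vector_derivative_mult[OF that cis'] by (simp add: algebra_simps)
  have Re': "((\<lambda>t. Re (f t)) has_real_derivative Re f') (at t)"
    if "(f has_vector_derivative f') (at t)" for f :: "real \<Rightarrow> complex" and f' t
    using bounded_linear.has_vector_derivative[OF bounded_linear_Re that]
    by (simp add: has_real_derivative_iff_has_vector_derivative)
  define r' where "r' = (\<lambda>t. Re ((vel G t - \<i> * G t) * cis (- t)))"
  define r'' where "r'' = (\<lambda>t. Re (((vel (vel G) t - \<i> * vel G t) - \<i> * (vel G t - \<i> * G t)) * cis (- t)))"
  have G_rot: "G t * cis (- t) = r t" for t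
    by (simp add: G_def polar_curve_def rcis_def cis_mult)
  have r': "(r has_real_derivative r' t) (at t)" for t
    using Re'[OF rotate[OF G'(1)[of t]]] by (simp add: G_rot r'_def)
  have "((\<lambda>t. vel G t - \<i> * G t) has_vector_derivative vel (vel G) t - \<i> * vel G t) (at t)" for t
    by (intro derivative_intros has_vector_derivative_mult_right G')
  from Re'[OF rotate[OF this]] have r'': "(r' has_real_derivative r'' t) (at t)" for t
    by (simp add: r'_def r''_def)
  have cis'': "(cis has_vector_derivative \<i> * cis t) (at t)" for t
    unfolding has_vector_derivative_def
    by (rule has_derivative_eq_rhs[OF has_derivative_cis[OF has_derivative_ident]])
      (simp add: scaleR_conv_of_real mult_ac)
  have vel_polar: "(G has_vector_derivative (r' t + \<i> * r t) * cis t) (at t)" for t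
    unfolding G_def polar_curve_def rcis_def
    using has_vector_derivative_mult[OF has_vector_derivative_of_real[OF r'] cis'', of t]
    by (simp add: algebra_simps)
  then have vel: "vel G = (\<lambda>t. (r' t + \<i> * r t) * cis t)"
    unfolding vel_def by (intro ext vector_derivative_at)
  have "(vel G has_vector_derivative (r'' t - r t + 2 * \<i> * r' t) * cis t) (at t)" for t
  proof -
    have "((\<lambda>t. r' t + \<i> * r t) has_vector_derivative r'' t + \<i> * r' t) (at t)"
      by (intro has_vector_derivative_add has_vector_derivative_mult_right
          has_vector_derivative_of_real r' r'')
    from has_vector_derivative_mult[OF this cis''] show ?thesis
      unfolding vel by (simp add: algebra_simps)
  qed
  then have vel2: "vel (vel G) = (\<lambda>t. (r'' t - r t + 2 * \<i> * r' t) * cis t)"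
    unfolding vel_def[of "vel G"] by (intro ext vector_derivative_at)
  have "curvature G t = (r t ^ 2 + 2 * r' t ^ 2 - r t * r'' t) / norm (vel G t) ^ 3" for t
  proof -
    have "cnj (vel G t) * vel (vel G) t
        = cnj (r' t + \<i> * r t) * (r'' t - r t + 2 * \<i> * r' t) * (cis (- t) * cis t)"
      unfolding vel2 by (simp add: vel cis_cnj mult_ac)
    also have "\<dots> = cnj (r' t + \<i> * r t) * (r'' t - r t + 2 * \<i> * r' t)"
      by (simp add: cis_mult)
    finally have "Im (cnj (vel G t) * vel (vel G) t)
        = Im (cnj (r' t + \<i> * r t) * (r'' t - r t + 2 * \<i> * r' t))"
      by (rule arg_cong)
    also have "\<dots> = r t ^ 2 + 2 * r' t ^ 2 - r t * r'' t"
      by (simp add: power2_eq_square algebra_simps)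
    finally have "Im (cnj (vel G t) * vel (vel G) t) = r t ^ 2 + 2 * r' t ^ 2 - r t * r'' t" .
    then show ?thesis by (simp add: curvature_def)
  qed
  with r' r'' show thesis
    unfolding G_def by (rule that)
qed

text \<open>Positive curvature translates into \<open>p + p'' > 0\<close> because
\<open>p + p'' = (r\<^sup>2 + 2 * r'\<^sup>2 - r * r'') / r ^ 3\<close> for \<open>p = 1 / r\<close>.\<close>

lemma support_function_inverse_radius:
  assumes "smooth_convex_closed_curve (polar_curve r)" and r_pos: "\<And>\<phi>. r \<phi> > 0"
  obtains p' p'' where "support_function (\<lambda>t. 1 / r t) p' p''"
proof -
  have smooth: "smooth_curve (polar_curve r)"
    and per: "\<And>t. polar_curve r (t + 2 * pi) = polar_curve r t"
    and curv: "\<And>t. curvature (polar_curve r) t > 0"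
    using assms(1) by (auto simp: smooth_convex_closed_curve_def)
  obtain r' r'' where r': "\<And>t. (r has_real_derivative r' t) (at t)"
    and r'': "\<And>t. (r' has_real_derivative r'' t) (at t)"
    and curv_eq: "\<And>t. curvature (polar_curve r) t
      = (r t ^ 2 + 2 * r' t ^ 2 - r t * r'' t) / norm (vel (polar_curve r) t) ^ 3"
    by (rule polar_curve_radius_derivs[OF smooth]) blast
  define p' where "p' = (\<lambda>t. - r' t / r t ^ 2)"
  define p'' where "p'' = (\<lambda>t. (2 * r' t ^ 2 - r t * r'' t) / r t ^ 3)"
  have "support_function (\<lambda>t. 1 / r t) p' p''"
  proof
    fix t
    have r0: "r t \<noteq> 0" using r_pos[of t] by simp
    show "((\<lambda>t. 1 / r t) has_real_derivative p' t) (at t)"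
      using r0 by (auto intro!: derivative_eq_intros r' simp: p'_def power2_eq_square)
    show "(p' has_real_derivative p'' t) (at t)"
      unfolding p'_def
      using r0 by (auto intro!: derivative_eq_intros r' r''
          simp: p''_def field_simps eval_nat_numeral)
    show "1 / r t > 0" using r_pos by simp
    show "1 / r (t + 2 * pi) = 1 / r t"
      using arg_cong[OF per[of t], of norm] r_pos[of t] r_pos[of "t + 2 * pi"]
      by (simp add: polar_curve_def)
    have "r t ^ 2 + 2 * r' t ^ 2 - r t * r'' t > 0"
      using curv[of t] unfolding curv_eq by (simp add: zero_less_divide_iff)
    then have "(r t ^ 2 + 2 * r' t ^ 2 - r t * r'' t) / r t ^ 3 > 0"
      using r_pos by simp
    also have "(r t ^ 2 + 2 * r' t ^ 2 - r t * r'' t) / r t ^ 3 = 1 / r t + p'' t"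
      using r0 by (simp add: p''_def field_simps eval_nat_numeral)
    finally show "1 / r t + p'' t > 0" .
  qed
  then show thesis by (rule that)
qed

section \<open>The angular billiard as a twist map\<close>

theorem theorem5:
  fixes c :: "real \<Rightarrow> complex" and r :: "real \<Rightarrow> real"
  assumes "smooth_convex_closed_curve c"
    and "0 \<in> inside (range c)"
    and "smooth_convex_closed_curve (polar_curve r)"
    and "0 \<in> inside (range (polar_curve r))"
    and "\<forall>\<phi>. r \<phi> > 0"
    and "range (polar_curve r) = dual_curve c"
  shows "(\<forall>M \<in> segment_domain (polar_curve r) - range (polar_curve r).
            preserves_symplectic_form_at (angular_billiard (polar_curve r)) M) \<and>
         (\<forall>M \<in> segment_domain (polar_curve r).
            (\<forall>\<phi>\<^sub>1. M = rcis (norm M) \<phi>\<^sub>1 \<longrightarrow> (\<exists>\<phi>\<^sub>2. lifted_angles (polar_curve r) M \<phi>\<^sub>1 \<phi>\<^sub>2)) \<and>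
            (\<forall>\<phi>\<^sub>1 \<phi>\<^sub>2. lifted_angles (polar_curve r) M \<phi>\<^sub>1 \<phi>\<^sub>2 \<longrightarrow>
               right_tangency_point (polar_curve r) M = polar_curve r ((\<phi>\<^sub>1 + \<phi>\<^sub>2) / 2) \<and>
               ((\<lambda>x. - generating_function r x \<phi>\<^sub>2) has_real_derivative 1 / norm M) (at \<phi>\<^sub>1) \<and>
               ((\<lambda>y. generating_function r \<phi>\<^sub>1 y) has_real_derivative
                  1 / norm (angular_billiard (polar_curve r) M)) (at \<phi>\<^sub>2))) \<and>
         (\<exists>W. open W \<and> range (polar_curve r) \<subseteq> W \<and>
              W \<inter> outer_region (polar_curve r) \<subseteq> segment_domain (polar_curve r) \<and>
              (\<forall>M \<in> W \<inter> outer_region (polar_curve r) - range (polar_curve r). \<forall>\<phi>\<^sub>1 \<phi>\<^sub>2.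
                 lifted_angles (polar_curve r) M \<phi>\<^sub>1 \<phi>\<^sub>2 \<longrightarrow>
                 twist_condition_at (generating_function r) \<phi>\<^sub>1 \<phi>\<^sub>2))"
proof -
  obtain p' p'' where "support_function (\<lambda>t. 1 / r t) p' p''"
    using support_function_inverse_radius[OF assms(3)] assms(5) by blast
  then interpret support_function "\<lambda>t. 1 / r t" p' p'' .
  have r: "1 / (1 / r t) = r t" for t by simp
  note in0 = assms(4)
  show ?thesis
  proof (intro conjI ballI allI impI)
    show "preserves_symplectic_form_at (angular_billiard (polar_curve r)) M"
      if "M \<in> segment_domain (polar_curve r) - range (polar_curve r)" for M
      using that preserves_symplectic_form[unfolded r, OF in0] by blast
    fix M assume M: "M \<in> segment_domain (polar_curve r)"
    show "\<exists>\<phi>\<^sub>2. lifted_angles (polar_curve r) M \<phi>\<^sub>1 \<phi>\<^sub>2" if "M = rcis (norm M) \<phi>\<^sub>1" for \<phi>\<^sub>1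
      by (rule lifted_angles_exist[unfolded r, OF in0 M that])
    fix \<phi>\<^sub>1 \<phi>\<^sub>2 assume "lifted_angles (polar_curve r) M \<phi>\<^sub>1 \<phi>\<^sub>2"
    note T = lifted_angles_tangency[unfolded r, OF in0 M this]
    show "right_tangency_point (polar_curve r) M = polar_curve r ((\<phi>\<^sub>1 + \<phi>\<^sub>2) / 2)"
      by (rule T)
    show "((\<lambda>x. - generating_function r x \<phi>\<^sub>2) has_real_derivative 1 / norm M) (at \<phi>\<^sub>1)"
      using generating_function_deriv_fst[unfolded r, of \<phi>\<^sub>2 \<phi>\<^sub>1] unfolding T .
    show "((\<lambda>y. generating_function r \<phi>\<^sub>1 y) has_real_derivative
        1 / norm (angular_billiard (polar_curve r) M)) (at \<phi>\<^sub>2)"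
      using generating_function_deriv_snd[unfolded r, of \<phi>\<^sub>1 \<phi>\<^sub>2] unfolding T .
  next
    obtain W where W: "open W" "range (polar_curve r) \<subseteq> W"
        "W \<inter> outer_region (polar_curve r) \<subseteq> segment_domain (polar_curve r)"
      using segment_domain_near_curve[unfolded r, OF in0] by blast
    have "twist_condition_at (generating_function r) \<phi>\<^sub>1 \<phi>\<^sub>2"
      if "M \<notin> range (polar_curve r)" "lifted_angles (polar_curve r) M \<phi>\<^sub>1 \<phi>\<^sub>2" for M \<phi>\<^sub>1 \<phi>\<^sub>2
    proof -
      have "0 < \<phi>\<^sub>2 - \<phi>\<^sub>1" "\<phi>\<^sub>2 - \<phi>\<^sub>1 < pi"
        using that by (simp_all add: lifted_angles_def)
      then show ?thesis
        using pi_gt_zero by (intro twist_condition[unfolded r]) linarith+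
    qed
    with W show "\<exists>W. open W \<and> range (polar_curve r) \<subseteq> W \<and>
        W \<inter> outer_region (polar_curve r) \<subseteq> segment_domain (polar_curve r) \<and>
        (\<forall>M \<in> W \<inter> outer_region (polar_curve r) - range (polar_curve r). \<forall>\<phi>\<^sub>1 \<phi>\<^sub>2.
           lifted_angles (polar_curve r) M \<phi>\<^sub>1 \<phi>\<^sub>2 \<longrightarrow>
           twist_condition_at (generating_function r) \<phi>\<^sub>1 \<phi>\<^sub>2)"
      by (intro exI[of _ W]) blast
  qed
qed

end
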